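(* Let $\phi$ be a method satisfying assumption A (see context) with constants $\bar\beta,\beta>0$, let $f\in F_r$, $\varphi\in(0,1)$, and let $h:(0,1)\to\mathbb R_+$ satisfy $h(\varepsilon)=O(\varepsilon^{1/(r+1)})$ as $\varepsilon\to0^+$. Then for all sufficiently small $\varepsilon>0$ the approximations $l_i$ computed by the algorithm ADAPT-MESH-GEN on its mesh $a=x_0<x_1<\dots<x_m=b$ satisfy $$\sup_{t\in[x_i,x_{i+1}]}\|z_i(t)-l_i(t)\|\le\varepsilon,\qquad i=0,1,\dots,m-1,$$ where $z_i$ is the local solution given by $z_i'(t)=f(t,z_i(t))$, $z_i(x_i)=y_i$.
   Context: **Problem.** Let $a<b$, $d,r\ge1$ integers, $\eta\in\mathbb R^d$, $\|\cdot\|$ the maximum norm in $\mathbb R^d$. Consider $z'(t)=f(t,z(t))$, $t\in[a,b]$, $z(a)=\eta$. $F_r$ is the class of continuous $f:[a,b]\times\mathbb R^d\to\mathbb R^d$ such that for some $L\ge0$, $\|f(t,y)-f(t,\bar y)\|\le L\|y-\bar y\|$ for all $t\in[a,b]$, $y,\bar y\in\mathbb R^d$, and $f\in C^r([a,b]\times D)$, where $D=\{y\in\mathbb R^d:\|y\|\le\sup_{t\in[a,b]}\|z(t)\|+1\}$ and $z$ is the unique solution. **Methods.** A method $\phi$ computes successively, for a mesh $a=x_0<\dots<x_m=b$ and starting with $y_0=\eta$, in each $[x_i,x_{i+1}]$ an approximation $l_i$ to the local solution $z_i$, with $l_i(x_i)=y_i$, and sets $y_{i+1}=l_i(x_{i+1})$;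 $l_i$ is determined by $f$, $x_i$, $x_{i+1}$ and $y_i$. **Assumption A** (with $\bar\beta,\beta>0$ independent of $f$): for any $f\in F_r$, and for any nonincreasing sequence $\ell(m)\to0$ and any constant $K$, there is $m_0$ such that for all $m\ge m_0$ and any mesh $\{x_i\}_{i=0}^m$ with $\max_i(x_{i+1}-x_i)\le K\ell(m)$, $$\sup_{t\in[x_i,x_{i+1}]}\|z_i(t)-l_i(t)\|\le\bar\beta\Bigl(\frac1{r!}\sup_{\alpha\in[x_i,x_{i+1}]}\|z_i^{(r+1)}(\alpha)\|+\beta\Bigr)(x_{i+1}-x_i)^{r+1},\quad i=0,\dots,m-1$$ (the right-hand side is read as $+\infty$ if $z_i^{(r+1)}$ does not exist on the whole interval). **Algorithm ADAPT-MESH-GEN.** Set $x_0=a$, $y_0=\eta$. Given $x_i<b$ and $y_i$: (1) $\bar x_{i+1}=x_i+\min\{h(\varepsilon),b-x_i\}$. (2) Compute an approximation $\bar l_i$ on $[x_i,\bar x_{i+1}]$ using $\phi$ (starting from $y_i$). (3) With $\tilde H_i(t)=f(t,\bar l_i(t))$ and equidistant points $\bar t_0=x_i,\bar t_1,\dots,\bar t_r=\bar x_{i+1}$, compute componentwise the divided difference $\tilde H_i[\bar t_0,\dots,\bar t_r]$. (4) $G_i=\frac43\bar\beta\bigl(\|\tilde H_i[\bar t_0,\dots,\bar t_r]\|+\beta\bigr)(1+\varphi)$. (5) $x_{i+1}=x_i+\min\{(\varepsilon/G_i)^{1/(r+1)},\,b-x_i\}$. (6) Compute an approximation $l_i$ on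 $[x_i,x_{i+1}]$ using $\phi$ (starting from $y_i$) and set $y_{i+1}=l_i(x_{i+1})$. Stop if $x_{i+1}=b$; otherwise continue with $i+1$. *)

theory Defs
  imports "HOL-Analysis.Analysis" "HOL-Library.Landau_Symbols"
begin

(* The maximum norm on real^'d is the library's infnorm. *)

type_synonym 'd rhs = "real \<Rightarrow> real^'d \<Rightarrow> real^'d"

(* A method maps f, x_i, x_{i+1}, y_i to the approximation l_i, a function of t. *)
type_synonym 'd ode_method = "'d rhs \<Rightarrow> real \<Rightarrow> real \<Rightarrow> real^'d \<Rightarrow> real \<Rightarrow> real^'d"


definition solves_ivp :: "'d::finite rhs \<Rightarrow> real \<Rightarrow> real \<Rightarrow> real^'d \<Rightarrow> (real \<Rightarrow> real^'d) \<Rightarrow> bool" where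
  "solves_ivp f u v y z \<longleftrightarrow>
     z u = y \<and> (\<forall>t\<in>{u..v}. (z has_vector_derivative f t (z t)) (at t within {u..v}))"

(* C^k on a set S, with derivatives taken within S. It is used below only for convex bodies,
   where the derivative g' is unique and the notion agrees with existence and continuity on S
   (one-sided at the boundary) of all partial derivatives of order at most k. *)
fun Ck_on :: "nat \<Rightarrow> ('v::real_normed_vector \<Rightarrow> 'w::real_normed_vector) \<Rightarrow> 'v set \<Rightarrow> bool" where
  "Ck_on 0 g S \<longleftrightarrow> continuous_on S g"
| "Ck_on (Suc k) g S \<longleftrightarrow>
     (\<exists>g'. (\<forall>p\<in>S. (g has_derivative g' p) (at p within S)) \<and> (\<forall>v. Ck_on k (\<lambda>p. g' p v) S))"

(* By the Lipschitz condition the solution z exists and is unique on {a..b}. *)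
definition F_class :: "real \<Rightarrow> real \<Rightarrow> real^'d::finite \<Rightarrow> nat \<Rightarrow> 'd rhs set" where
  "F_class a b \<eta> r = {f.
     continuous_on ({a..b} \<times> UNIV) (\<lambda>(t, y). f t y) \<and>
     (\<exists>L\<ge>0. \<forall>t\<in>{a..b}. \<forall>y y'. infnorm (f t y - f t y') \<le> L * infnorm (y - y')) \<and>
     (\<exists>z. solves_ivp f a b \<eta> z \<and>
        Ck_on r (\<lambda>(t, y). f t y)
          ({a..b} \<times> {y. infnorm y \<le> (SUP t\<in>{a..b}. infnorm (z t)) + 1}))}"


definition nth_vderiv :: "nat \<Rightarrow> real set \<Rightarrow> (real \<Rightarrow> real^'d::finite) \<Rightarrow> real \<Rightarrow> real^'d" where
  "nth_vderiv n S z = ((\<lambda>g t. vector_derivative g (at t within S)) ^^ n) z"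

definition nth_differentiable :: "nat \<Rightarrow> real set \<Rightarrow> (real \<Rightarrow> real^'d::finite) \<Rightarrow> bool" where
  "nth_differentiable n S z \<longleftrightarrow>
     (\<forall>k<n. \<forall>t\<in>S. nth_vderiv k S z differentiable (at t within S))"

definition sup_nth_vderiv :: "nat \<Rightarrow> real set \<Rightarrow> (real \<Rightarrow> real^'d::finite) \<Rightarrow> ereal" where
  "sup_nth_vderiv n S z =
     (if nth_differentiable n S z then SUP t\<in>S. ereal (infnorm (nth_vderiv n S z t)) else \<infinity>)"


definition mesh :: "real \<Rightarrow> real \<Rightarrow> nat \<Rightarrow> (nat \<Rightarrow> real) \<Rightarrow> bool" where
  "mesh a b m x \<longleftrightarrow> x 0 = a \<and> x m = b \<and> (\<forall>i<m. x i < x (Suc i))"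

definition is_method :: "real \<Rightarrow> real \<Rightarrow> real^'d::finite \<Rightarrow> nat \<Rightarrow> 'd ode_method \<Rightarrow> bool" where
  "is_method a b \<eta> r \<phi> \<longleftrightarrow>
     (\<forall>f\<in>F_class a b \<eta> r. \<forall>u v y. a \<le> u \<and> u < v \<and> v \<le> b \<longrightarrow> \<phi> f u v y u = y)"

primrec method_value ::
    "'d::finite ode_method \<Rightarrow> 'd rhs \<Rightarrow> real^'d \<Rightarrow> (nat \<Rightarrow> real) \<Rightarrow> nat \<Rightarrow> real^'d" where
  "method_value \<phi> f \<eta> x 0 = \<eta>"
| "method_value \<phi> f \<eta> x (Suc i) = \<phi> f (x i) (x (Suc i)) (method_value \<phi> f \<eta> x i) (x (Suc i))"

definition assumption_A ::
    "real \<Rightarrow> real \<Rightarrow> real^'d::finite \<Rightarrow> nat \<Rightarrow> real \<Rightarrow> real \<Rightarrow> 'd ode_method \<Rightarrow> bool" where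
  "assumption_A a b \<eta> r \<beta>bar \<beta> \<phi> \<longleftrightarrow>
     (\<forall>f\<in>F_class a b \<eta> r. \<forall>l K. decseq l \<and> l \<longlonglongrightarrow> 0 \<longrightarrow>
       (\<exists>m0. \<forall>m\<ge>m0. \<forall>x. mesh a b m x \<and> (\<forall>i<m. x (Suc i) - x i \<le> K * l m) \<longrightarrow>
         (\<forall>i<m. \<forall>z. let y = method_value \<phi> f \<eta> x i; I = {x i..x (Suc i)} in
            solves_ivp f (x i) (x (Suc i)) y z \<longrightarrow>
            (SUP t\<in>I. ereal (infnorm (z t - \<phi> f (x i) (x (Suc i)) y t)))
              \<le> ereal \<beta>bar * (ereal (1 / fact r) * sup_nth_vderiv (r + 1) I z + ereal \<beta>)
                  * ereal ((x (Suc i) - x i) ^ (r + 1)))))"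


(* divided_diff H t i k is the divided difference H[t i, ..., t (i + k)]. *)
fun divided_diff :: "(real \<Rightarrow> real^'d::finite) \<Rightarrow> (nat \<Rightarrow> real) \<Rightarrow> nat \<Rightarrow> nat \<Rightarrow> real^'d" where
  "divided_diff H t i 0 = H (t i)"
| "divided_diff H t i (Suc k) =
     (divided_diff H t (Suc i) k - divided_diff H t i k) /\<^sub>R (t (i + Suc k) - t i)"

(* G_i as a function of x = x_i and y = y_i. The parameter \<kappa> is the safety factor varphi in (0,1),
   renamed to keep it apart from the method \<phi>. *)
definition adapt_G ::
    "'d::finite ode_method \<Rightarrow> real \<Rightarrow> nat \<Rightarrow> real \<Rightarrow> real \<Rightarrow> real \<Rightarrow> (real \<Rightarrow> real) \<Rightarrow> 'd rhs
      \<Rightarrow> real \<Rightarrow> real \<Rightarrow> real^'d \<Rightarrow> real" where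
  "adapt_G \<phi> b r \<beta>bar \<beta> \<kappa> h f \<epsilon> x y =
     (let xbar = x + min (h \<epsilon>) (b - x);
          lbar = \<phi> f x xbar y;
          H = (\<lambda>t. f t (lbar t));
          tbar = (\<lambda>j. x + real j * (xbar - x) / real r)
      in 4 / 3 * \<beta>bar * (infnorm (divided_diff H tbar 0 r) + \<beta>) * (1 + \<kappa>))"

(* A run of ADAPT-MESH-GEN that stops after m steps, with nodes x 0, ..., x m and values
   y 0, ..., y m; entries with index above m are irrelevant. *)
definition adapt_mesh_gen ::
    "'d::finite ode_method \<Rightarrow> real \<Rightarrow> real \<Rightarrow> real^'d \<Rightarrow> nat \<Rightarrow> real \<Rightarrow> real \<Rightarrow> real \<Rightarrow> (real \<Rightarrow> real)
      \<Rightarrow> 'd rhs \<Rightarrow> real \<Rightarrow> nat \<Rightarrow> (nat \<Rightarrow> real) \<Rightarrow> (nat \<Rightarrow> real^'d) \<Rightarrow> bool" where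
  "adapt_mesh_gen \<phi> a b \<eta> r \<beta>bar \<beta> \<kappa> h f \<epsilon> m x y \<longleftrightarrow>
     x 0 = a \<and> y 0 = \<eta> \<and>
     (\<forall>i<m. x i < b \<and>
        x (Suc i) = x i + min ((\<epsilon> / adapt_G \<phi> b r \<beta>bar \<beta> \<kappa> h f \<epsilon> (x i) (y i)) powr (1 / real (r + 1)))
                              (b - x i) \<and>
        y (Suc i) = \<phi> f (x i) (x (Suc i)) (y i) (x (Suc i))) \<and>
     x m = b"

end

theory Submission
  imports Defs
begin

text \<open>
The theorem holds because the quantity $G_i$ computed from a trial step dominates the constant in
the local error bound of assumption A, so that a step with $G_i (x_{i+1}-x_i)^{r+1} \le \varepsilon$
has local error at most $\varepsilon$.

Assumption A speaks about sequences of meshes, whereas a run has its own mesh, and its number of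
steps is not controlled in advance. A choice of the null sequence adapted to a hypothetical
sequence of counterexamples removes this mismatch (\<open>fine_mesh_threshold\<close>): below some step size
$\delta$ the local bound holds on every mesh. Since a partial mesh extends to a full one, the bound is
also available for each trial step and for runs not yet known to terminate
(\<open>assumption_A_uniform\<close>).

Let $F_0 = f$ and let $F_{j+1}$ be the derivative of $F_j$ in direction $(1, f)$. A local solution $w$
in the tube of radius 1 around $z$ has $w^{(j+1)}(t) = F_j(t, w(t))$ for $j \le r$, and $F_r$ is bounded and
uniformly continuous on the compact set where $f$ is of class $C^r$. The local errors are
$O(\delta (x_{i+1}-x_i))$, hence the computed values stay close to $z$ (\<open>method_value_near\<close>) and
all local solutions remain in the tube. The trial divided difference is then as close as desired to
$F_r(x_i,y_i)/r!$ (\<open>trial_divided_diff\<close>), as are the values of $w^{(r+1)}/r!$ over the actual step;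
a total deviation of $\beta/3$ is absorbed by the factor $4/3$ in $G_i$, since
$(p + \beta/3) + \beta \le \frac43 (p + \beta)$ for $p \ge 0$ (\<open>step_error\<close>).

The same estimate bounds $G_i$ from above, which bounds the steps below and makes the run
terminate, while $G_i \ge \frac43\bar\beta\beta$ makes all steps tend to zero with $\varepsilon$.
\<close>

section \<open>Short-time existence and stability\<close>

text \<open>A constant extension outside \<^term>\<open>{u..v}\<close> turns the integral operator into a self-map of the
complete space of bounded continuous functions, where it is a contraction.\<close>

lemma lipschitz_solution_exists:
  fixes f :: "'d::finite rhs"
  assumes uv: "u \<le> v"
    and cont: "continuous_on ({u..v} \<times> UNIV) (\<lambda>(t, y). f t y)"
    and lip: "\<And>t y y'. t \<in> {u..v} \<Longrightarrow> norm (f t y - f t y') \<le> L * norm (y - y')"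
    and L: "0 \<le> L" "L * (v - u) \<le> 1/2"
  shows "\<exists>w. solves_ivp f u v y w"
proof -
  define T where "T g t = y + integral {u..t} (\<lambda>s. f s (apply_bcontfun g s))" for g t
  have cf: "continuous_on {u..v} (\<lambda>s. f s (apply_bcontfun g s))" for g
  proof -
    have "continuous_on {u..v} (\<lambda>s. (\<lambda>(t, y). f t y) (s, apply_bcontfun g s))"
      by (rule continuous_on_compose2[OF cont]) (auto intro!: continuous_intros)
    then show ?thesis by simp
  qed
  have int: "(\<lambda>s. f s (apply_bcontfun g s)) integrable_on {u..t}" if "t \<le> v" for g t
    by (rule integrable_continuous_real[OF continuous_on_subset[OF cf]]) (use that in auto)
  have contT: "continuous_on (cbox u v) (T g)" for g
    unfolding T_def using indefinite_integral_continuous_1[OF int[OF order_refl]]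
    by (auto intro!: continuous_intros)
  have inb: "(\<lambda>t. T g (clamp u v t)) \<in> bcontfun" for g
    unfolding bcontfun_def
    using clamp_continuous_on[OF contT] clamp_bounded[OF compact_imp_bounded[OF compact_continuous_image[OF contT]]]
    by auto
  define B where "B g = Bcontfun (\<lambda>t. T g (clamp u v t))" for g
  have B: "apply_bcontfun (B g) t = T g (clamp u v t)" for g t
    unfolding B_def using Bcontfun_inverse[OF inb] by metis
  have contr: "dist (B g) (B g') \<le> 1/2 * dist g g'" for g g'
  proof (rule dist_bound)
    fix x :: real
    define t where "t = clamp u v x"
    have "t \<in> cbox u v" unfolding t_def by (rule clamp_in_interval) (use uv in auto)
    then have t: "u \<le> t" "t \<le> v" by auto
    have "dist (apply_bcontfun (B g) x) (apply_bcontfun (B g') x)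
      = norm (integral {u..t} (\<lambda>s. f s (apply_bcontfun g s) - f s (apply_bcontfun g' s)))"
      using integral_diff[OF int[OF t(2)] int[OF t(2)], of g g']
      by (simp add: B T_def t_def dist_norm)
    also have "\<dots> \<le> L * dist g g' * (t - u)"
    proof (rule integral_bound[OF t(1)])
      show "continuous_on {u..t} (\<lambda>s. f s (apply_bcontfun g s) - f s (apply_bcontfun g' s))"
        using t by (intro continuous_on_diff continuous_on_subset[OF cf]) auto
      fix s assume s: "s \<in> {u..t}"
      have "norm (f s (apply_bcontfun g s) - f s (apply_bcontfun g' s))
          \<le> L * dist (apply_bcontfun g s) (apply_bcontfun g' s)"
        unfolding dist_norm by (rule lip) (use s t in auto)
      also have "\<dots> \<le> L * dist g g'"
        by (intro mult_left_mono dist_bounded L)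
      finally show "norm (f s (apply_bcontfun g s) - f s (apply_bcontfun g' s)) \<le> L * dist g g'" .
    qed
    also have "\<dots> = (L * (t - u)) * dist g g'" by simp
    also have "L * (t - u) \<le> L * (v - u)" using t L by (intro mult_left_mono) auto
    also have "L * (v - u) * dist g g' \<le> 1/2 * dist g g'" using L by (intro mult_right_mono) auto
    finally show "dist (apply_bcontfun (B g) x) (apply_bcontfun (B g') x) \<le> 1/2 * dist g g'"
      by (simp add: mult_right_mono)
  qed
  obtain g where g: "B g = g"
    using banach_fix_type[of "1/2" B] contr by auto
  have gT: "apply_bcontfun g t = T g t" if "t \<in> {u..v}" for t
    using B[of g t] that unfolding g by (simp add: clamp_cancel_cbox)
  have "solves_ivp f u v y (apply_bcontfun g)"
    unfolding solves_ivp_def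
  proof (intro conjI ballI)
    show "apply_bcontfun g u = y" using gT[of u] uv by (simp add: T_def)
    fix t assume t: "t \<in> {u..v}"
    have "(T g has_vector_derivative f t (apply_bcontfun g t)) (at t within {u..v})"
      unfolding T_def[abs_def]
      using integral_has_vector_derivative[OF cf t, of g]
      by (auto intro!: derivative_eq_intros)
    then show "(apply_bcontfun g has_vector_derivative f t (apply_bcontfun g t)) (at t within {u..v})"
      by (rule has_vector_derivative_transform[OF t, rotated]) (use gT in auto)
  qed
  then show ?thesis by blast
qed

lemma vector_derivative_increment_bound:
  fixes g :: "real \<Rightarrow> 'a::real_normed_vector"
  assumes "\<And>t. t \<in> {u..v} \<Longrightarrow> (g has_vector_derivative g' t) (at t within {u..v})"
    and "\<And>t. t \<in> {u..v} \<Longrightarrow> norm (g' t - c) \<le> B"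
    and "s \<in> {u..v}" "t \<in> {u..v}"
  shows "norm (g t - g s - (t - s) *\<^sub>R c) \<le> B * \<bar>t - s\<bar>"
proof -
  have "norm ((g t - t *\<^sub>R c) - (g s - s *\<^sub>R c)) \<le> B * norm (t - s)"
  proof (rule differentiable_bound[of "{u..v}" _ "\<lambda>t h. h *\<^sub>R (g' t - c)"])
    fix x assume x: "x \<in> {u..v}"
    show "((\<lambda>t. g t - t *\<^sub>R c) has_derivative (\<lambda>h. h *\<^sub>R (g' x - c))) (at x within {u..v})"
      using assms(1)[OF x] unfolding has_vector_derivative_def
      by (auto intro!: derivative_eq_intros simp: algebra_simps)
    have "0 \<le> B" using assms(2)[OF x] norm_ge_zero order_trans by blast
    then show "onorm (\<lambda>h. h *\<^sub>R (g' x - c)) \<le> B"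
      using assms(2)[OF x] by (intro onorm_bound) (auto simp: mult.commute[of B] intro: mult_left_mono)
  qed (use assms in auto)
  then show ?thesis by (simp add: algebra_simps)
qed

lemma solves_ivp_subinterval:
  assumes "solves_ivp f a b y z" "a \<le> u" "v \<le> b"
  shows "solves_ivp f u v (z u) z"
  using assms unfolding solves_ivp_def
  by (auto intro: has_vector_derivative_within_subset[where S = "{a..b}"])

text \<open>On a short interval the maximum $B$ of the distance satisfies $B \le e + L (v-u) B$ with $e$
the initial distance; solving for $B$ makes a Gronwall argument superfluous.\<close>

lemma lipschitz_solution_stability:
  fixes f :: "'d::finite rhs"
  assumes uv: "u \<le> v"
    and lip: "\<And>t y y'. t \<in> {u..v} \<Longrightarrow> norm (f t y - f t y') \<le> L * norm (y - y')"
    and L: "0 \<le> L" "L * (v - u) \<le> 1/2"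
    and sol: "solves_ivp f u v y w" "solves_ivp f u v y' w'"
    and t: "t \<in> {u..v}"
  shows "norm (w t - w' t) \<le> (1 + 2 * L * (v - u)) * norm (y - y')"
proof -
  let ?e = "norm (y - y')"
  have der: "((\<lambda>t. w t - w' t) has_vector_derivative f t (w t) - f t (w' t)) (at t within {u..v})"
    if "t \<in> {u..v}" for t
    using sol that unfolding solves_ivp_def by (auto intro!: derivative_intros)
  have "continuous_on {u..v} (\<lambda>t. norm (w t - w' t))"
    by (rule continuous_on_norm, rule continuous_on_vector_derivative[OF der])
  then obtain s where s: "s \<in> {u..v}" and max: "\<forall>t\<in>{u..v}. norm (w t - w' t) \<le> norm (w s - w' s)"
    using continuous_attains_sup[of "{u..v}" "\<lambda>t. norm (w t - w' t)"] uv by auto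
  let ?B = "norm (w s - w' s)"
  have "norm ((w s - w' s) - (w u - w' u) - (s - u) *\<^sub>R 0) \<le> (L * ?B) * \<bar>s - u\<bar>"
  proof (rule vector_derivative_increment_bound[OF der])
    fix t assume t: "t \<in> {u..v}"
    have "norm (f t (w t) - f t (w' t)) \<le> L * norm (w t - w' t)" by (rule lip[OF t])
    also have "\<dots> \<le> L * ?B" using max t L by (intro mult_left_mono) auto
    finally show "norm (f t (w t) - f t (w' t) - 0) \<le> L * ?B" by simp
  qed (use s uv in auto)
  also have "\<dots> = (L * (s - u)) * ?B" using s by simp
  also have "\<dots> \<le> (L * (v - u)) * ?B"
    using s L by (intro mult_right_mono mult_left_mono) auto
  finally have "norm ((w s - w' s) - (w u - w' u)) \<le> L * (v - u) * ?B" by simp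
  moreover have "w u - w' u = y - y'" using sol by (simp add: solves_ivp_def)
  ultimately have B1: "?B \<le> ?e + L * (v - u) * ?B"
    by (smt (verit, best) norm_triangle_sub)
  also have "\<dots> \<le> ?e + 1/2 * ?B" using L by (intro add_left_mono mult_right_mono) auto
  finally have "?B \<le> 2 * ?e" by simp
  then have "L * (v - u) * ?B \<le> L * (v - u) * (2 * ?e)"
    using L uv by (intro mult_left_mono) auto
  with B1 have "?B \<le> (1 + 2 * L * (v - u)) * ?e" by (simp add: algebra_simps)
  then show ?thesis using max t by force
qed

section \<open>Divided differences at equidistant nodes\<close>

lemma divided_diff_diff:
  "divided_diff (\<lambda>t. A t - B t) n i k = divided_diff A n i k - divided_diff B n i k"
proof (induction k arbitrary: i)
  case (Suc k)
  show ?case unfolding divided_diff.simps Suc.IH by (simp add: algebra_simps)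
qed simp

lemma divided_diff_scaleR:
  "divided_diff (\<lambda>t. c *\<^sub>R A t) n i k = c *\<^sub>R divided_diff A n i k"
  by (induction k arbitrary: i) (simp_all add: algebra_simps)

lemma divided_diff_shift:
  assumes n: "\<And>j. n j = u + real j * s"
  shows "divided_diff A n (Suc i) k = divided_diff (\<lambda>t. A (t + s)) n i k"
  by (induction k arbitrary: i) (simp_all add: n algebra_simps)

text \<open>One step of the recursion at equidistant nodes is the divided difference, of one order less,
of the difference quotient.\<close>

lemma divided_diff_Suc_quotient:
  assumes n: "\<And>j. n j = u + real j * s" and s: "s > 0"
  shows "divided_diff A n i (Suc k)
    = divided_diff (\<lambda>t. (A (t + s) - A t) /\<^sub>R s) n i k /\<^sub>R real (Suc k)"
proof -
  have "n (i + Suc k) - n i = real (Suc k) * s" by (simp add: n algebra_simps)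
  then show ?thesis
    by (simp add: divided_diff_shift[OF n] divided_diff_diff divided_diff_scaleR
        del: of_nat_Suc)
qed

text \<open>A divided difference of order $k$ is nearly the $k$-th derivative over $k!$ when that derivative
$G_k$ is nearly constant. Passing to difference quotients lowers the order and, by the mean value
inequality, keeps the deviation $\omega$; this argument is free of intermediate points and hence
valid for vector-valued functions.\<close>

lemma divided_diff_near_derivative:
  fixes G :: "nat \<Rightarrow> real \<Rightarrow> real^'d::finite"
  assumes n: "\<And>j. n j = u + real j * s" and s: "s > 0" and v: "u + real k * s \<le> v"
    and der: "\<And>j t. j < k \<Longrightarrow> t \<in> {u..v} \<Longrightarrow>
      (G j has_vector_derivative G (Suc j) t) (at t within {u..v})"
    and osc: "\<And>t. t \<in> {u..v} \<Longrightarrow> norm (G k t - c) \<le> \<omega>"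
  shows "norm (divided_diff (G 0) n 0 k - c /\<^sub>R fact k) \<le> \<omega> / fact k"
  using v der osc
proof (induction k arbitrary: G v)
  case 0
  then show ?case using n by simp
next
  case (Suc k)
  define Q where "Q j t = (G j (t + s) - G j t) /\<^sub>R s" for j t
  have sub: "t \<in> {u..v}" "t + s \<in> {u..v}" if "t \<in> {u..v - s}" for t
    using that s by auto
  have "norm (divided_diff (Q 0) n 0 k - c /\<^sub>R fact k) \<le> \<omega> / fact k"
  proof (rule Suc.IH)
    show "u + real k * s \<le> v - s" using Suc.prems(1) by (simp add: algebra_simps)
  next
    fix j t assume j: "j < k" and t: "t \<in> {u..v - s}"
    have 1: "(G j has_vector_derivative G (Suc j) t) (at t within {u..v - s})"
      by (rule has_vector_derivative_within_subset[OF Suc.prems(2)]) (use j sub[OF t] s in auto)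
    have "(G j has_vector_derivative G (Suc j) (t + s)) (at (t + s) within (\<lambda>x. x + s) ` {u..v - s})"
      by (rule has_vector_derivative_within_subset[OF Suc.prems(2)]) (use j sub[OF t] s in auto)
    moreover have "((\<lambda>x. x + s) has_vector_derivative 1) (at t within {u..v - s})"
      by (auto intro!: derivative_eq_intros)
    ultimately
    have 2: "((\<lambda>x. G j (x + s)) has_vector_derivative G (Suc j) (t + s)) (at t within {u..v - s})"
      using vector_diff_chain_within[of "\<lambda>x. x + s" 1] by (fastforce simp: o_def)
    show "(Q j has_vector_derivative Q (Suc j) t) (at t within {u..v - s})"
      unfolding Q_def[abs_def]
      using has_vector_derivative_scaleR[OF DERIV_const has_vector_derivative_diff[OF 2 1], of "inverse s"]
      by simp
  next
    fix t assume t: "t \<in> {u..v - s}"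
    have "norm (G k (t + s) - G k t - ((t + s) - t) *\<^sub>R c) \<le> \<omega> * \<bar>(t + s) - t\<bar>"
      by (rule vector_derivative_increment_bound[OF Suc.prems(2) Suc.prems(3)]) (use sub[OF t] in auto)
    then have "norm (G k (t + s) - G k t - s *\<^sub>R c) / s \<le> \<omega>"
      using s by (simp add: field_simps)
    moreover have "Q k t - c = (G k (t + s) - G k t - s *\<^sub>R c) /\<^sub>R s"
      using s by (simp add: Q_def algebra_simps)
    ultimately show "norm (Q k t - c) \<le> \<omega>"
      using s by (simp add: divide_inverse mult.commute)
  qed
  moreover have "divided_diff (G 0) n 0 (Suc k) - c /\<^sub>R fact (Suc k)
      = (divided_diff (Q 0) n 0 k - c /\<^sub>R fact k) /\<^sub>R real (Suc k)"
    by (simp add: divided_diff_Suc_quotient[OF n s] Q_def[abs_def] scaleR_diff_right[of "inverse (real (Suc k))"]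
        del: divided_diff.simps of_nat_Suc)
  ultimately show ?case
    by (simp add: divide_simps mult.commute del: divided_diff.simps of_nat_Suc)
qed

text \<open>Each of the $k$ levels of the recursion at most doubles the numerator and divides by a difference
of nodes, which is at least $s$.\<close>

lemma divided_diff_bound:
  assumes n: "\<And>j. n j = u + real j * s" and s: "s > 0"
    and e: "\<And>j. i \<le> j \<Longrightarrow> j \<le> i + k \<Longrightarrow> norm (E (n j)) \<le> e"
  shows "norm (divided_diff E n i k) \<le> (2 / s) ^ k * e"
  using e
proof (induction k arbitrary: i)
  case 0
  then show ?case by simp
next
  case (Suc k)
  let ?q = "n (i + Suc k) - n i"
  have q: "?q = real (Suc k) * s" by (simp add: n algebra_simps)
  have qs: "s \<le> ?q" unfolding q using s by simp
  have "norm (divided_diff E n (Suc i) k - divided_diff E n i k)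
      \<le> (2 / s) ^ k * e + (2 / s) ^ k * e"
    by (intro order_trans[OF norm_triangle_ineq4] add_mono Suc.IH Suc.prems) auto
  then have "norm (divided_diff E n (Suc i) k - divided_diff E n i k) / ?q
      \<le> 2 * ((2 / s) ^ k * e) / ?q"
    using qs s by (intro divide_right_mono) linarith+
  also have "\<dots> \<le> 2 * ((2 / s) ^ k * e) / s"
  proof -
    have "0 \<le> e" using Suc.prems[of i] norm_ge_zero[of "E (n i)"] by linarith
    then show ?thesis using qs s by (intro divide_left_mono) auto
  qed
  finally have "norm (divided_diff E n (Suc i) k - divided_diff E n i k) / ?q
      \<le> (2 / s) ^ Suc k * e" by simp
  moreover have "norm (divided_diff E n i (Suc k))
      = norm (divided_diff E n (Suc i) k - divided_diff E n i k) / ?q"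
    using qs s by (simp add: divide_inverse mult.commute)
  ultimately show ?case by simp
qed

section \<open>Higher derivatives of solutions\<close>

lemma Ck_on_imp_continuous_on: "Ck_on k g S \<Longrightarrow> continuous_on S g"
  by (cases k) (auto simp: continuous_on_eq_continuous_within intro: has_derivative_continuous)

lemma Ck_on_SucD: "Ck_on (Suc k) g S \<Longrightarrow> Ck_on k g S"
proof (induction k arbitrary: g)
  case 0
  then show ?case using Ck_on_imp_continuous_on[of "Suc 0" g S] by simp
next
  case (Suc k)
  then obtain g' where "\<forall>p\<in>S. (g has_derivative g' p) (at p within S)"
    and "\<forall>v. Ck_on (Suc k) (\<lambda>p. g' p v) S"
    by (subst (asm) Ck_on.simps) blast
  then show ?case using Suc.IH unfolding Ck_on.simps(2) by blast
qed

lemma Ck_on_const: "Ck_on k (\<lambda>p. c) S"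
  by (induction k arbitrary: c) (auto intro!: exI[of _ "\<lambda>p h. 0"])

lemma Ck_on_add:
  assumes "Ck_on k g S" "Ck_on k h S"
  shows "Ck_on k (\<lambda>p. g p + h p) S"
  using assms
proof (induction k arbitrary: g h)
  case 0
  then show ?case by (simp add: continuous_on_add)
next
  case (Suc k)
  then obtain g' h' where "\<forall>p\<in>S. (g has_derivative g' p) (at p within S)"
    "\<forall>p\<in>S. (h has_derivative h' p) (at p within S)"
    and "\<forall>v. Ck_on k (\<lambda>p. g' p v) S" "\<forall>v. Ck_on k (\<lambda>p. h' p v) S"
    by auto
  then show ?case using Suc.IH
    by (auto intro!: exI[of _ "\<lambda>p v. g' p v + h' p v"] has_derivative_add)
qed

lemma Ck_on_sum:
  "(\<And>i. i \<in> I \<Longrightarrow> Ck_on k (g i) S) \<Longrightarrow> Ck_on k (\<lambda>p. \<Sum>i\<in>I. g i p) S"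
  by (induction I rule: infinite_finite_induct) (simp_all add: Ck_on_const Ck_on_add)

lemma Ck_on_scaleR:
  assumes "Ck_on k u S" "Ck_on k g S"
  shows "Ck_on k (\<lambda>p. u p *\<^sub>R g p) S"
  using assms
proof (induction k arbitrary: u g)
  case 0
  then show ?case by (simp add: continuous_on_scaleR)
next
  case (Suc k)
  then obtain u' g' where der: "\<forall>p\<in>S. (u has_derivative u' p) (at p within S)"
    "\<forall>p\<in>S. (g has_derivative g' p) (at p within S)"
    and "\<forall>v. Ck_on k (\<lambda>p. u' p v) S" "\<forall>v. Ck_on k (\<lambda>p. g' p v) S"
    by auto
  moreover have "Ck_on k u S" "Ck_on k g S" using Suc.prems by (blast intro: Ck_on_SucD)+
  ultimately have "Ck_on k (\<lambda>p. u p *\<^sub>R g' p v + u' p v *\<^sub>R g p) S" for v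
    using Suc.IH by (intro Ck_on_add) blast+
  then show ?case
    using der by (auto intro!: exI[of _ "\<lambda>p v. u p *\<^sub>R g' p v + u' p v *\<^sub>R g p"] has_derivative_scaleR)
qed

lemma Ck_on_inner_right:
  "Ck_on k g S \<Longrightarrow> Ck_on k (\<lambda>p. g p \<bullet> c) S"
proof (induction k arbitrary: g)
  case 0
  then show ?case by (simp add: continuous_on_inner)
next
  case (Suc k)
  then obtain g' where "\<forall>p\<in>S. (g has_derivative g' p) (at p within S)"
    and "\<forall>v. Ck_on k (\<lambda>p. g' p v) S"
    by auto
  then show ?case using Suc.IH
    by (auto intro!: exI[of _ "\<lambda>p v. g' p v \<bullet> c"] has_derivative_inner_left)
qed

text \<open>The total derivative \<open>g\<^sub>t + g\<^sub>y f\<close> along the flow: expanding $f$ in a basis writes the derivative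
in the variable direction $(1, f)$ through derivatives in fixed directions.\<close>

lemma Ck_on_flow_derivative:
  fixes g f :: "real \<times> 'a::euclidean_space \<Rightarrow> 'a"
  assumes "Ck_on (Suc k) g S" and f: "Ck_on k f S"
  obtains g' g1 where "\<And>p. p \<in> S \<Longrightarrow> (g has_derivative g' p) (at p within S)"
    and "\<And>p. p \<in> S \<Longrightarrow> g1 p = g' p (1, f p)" and "Ck_on k g1 S"
proof -
  obtain g' where der: "\<And>p. p \<in> S \<Longrightarrow> (g has_derivative g' p) (at p within S)"
    and g': "\<And>v. Ck_on k (\<lambda>p. g' p v) S"
    using assms(1) by auto
  define g1 where "g1 p = g' p (1, 0) + (\<Sum>i\<in>Basis. (f p \<bullet> i) *\<^sub>R g' p (0, i))" for p
  have "g1 p = g' p (1, f p)" if "p \<in> S" for p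
  proof -
    have lin: "linear (g' p)" using der[OF that] by (rule has_derivative_linear)
    have "(1, f p) = (1, 0) + (\<Sum>i\<in>Basis. (f p \<bullet> i) *\<^sub>R (0 :: real, i))"
      by (simp add: prod_eq_iff fst_sum snd_sum euclidean_representation)
    then show ?thesis
      by (simp only: g1_def linear_add[OF lin] linear_sum[OF lin] linear_cmul[OF lin])
  qed
  moreover have "Ck_on k g1 S"
    unfolding g1_def[abs_def] by (intro Ck_on_add Ck_on_sum Ck_on_scaleR Ck_on_inner_right g' f)
  ultimately show thesis using that der by blast
qed

lemma Ck_on_flow_chain:
  fixes g f :: "real \<times> 'a::euclidean_space \<Rightarrow> 'a"
  assumes "Ck_on k g S" "Ck_on k f S"
  shows "\<exists>F. F 0 = g \<and> (\<forall>j\<le>k. continuous_on S (F j)) \<and>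
    (\<forall>j<k. \<exists>D. \<forall>p\<in>S. (F j has_derivative D p) (at p within S) \<and> F (Suc j) p = D p (1, f p))"
  using assms
proof (induction k arbitrary: g)
  case 0
  then show ?case by (intro exI[of _ "\<lambda>j. g"]) simp
next
  case (Suc k)
  have f: "Ck_on k f S" using Suc.prems(2) by (rule Ck_on_SucD)
  obtain g' g1 where g': "\<And>p. p \<in> S \<Longrightarrow> (g has_derivative g' p) (at p within S)"
      "\<And>p. p \<in> S \<Longrightarrow> g1 p = g' p (1, f p)" and g1: "Ck_on k g1 S"
    using Ck_on_flow_derivative[OF Suc.prems(1) f] by metis
  obtain F where F: "F 0 = g1" "\<forall>j\<le>k. continuous_on S (F j)"
    "\<forall>j<k. \<exists>D. \<forall>p\<in>S. (F j has_derivative D p) (at p within S) \<and> F (Suc j) p = D p (1, f p)"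
    using Suc.IH[OF g1 f] by auto
  show ?case
  proof (intro exI[of _ "case_nat g F"] conjI allI impI)
    fix j assume "j \<le> Suc k"
    then show "continuous_on S (case_nat g F j)"
      using F(2) Ck_on_imp_continuous_on[OF Suc.prems(1)] by (cases j) auto
  next
    fix j assume j: "j < Suc k"
    have "\<exists>D. \<forall>p\<in>S. (g has_derivative D p) (at p within S) \<and> F 0 p = D p (1, f p)"
      using F(1) g' by (intro exI[of _ g']) auto
    with j show "\<exists>D. \<forall>p\<in>S. (case_nat g F j has_derivative D p) (at p within S) \<and>
        case_nat g F (Suc j) p = D p (1, f p)"
      using F(3) by (cases j) auto
  qed simp
qed

lemma has_vector_derivative_along_graph:
  fixes g :: "real \<times> 'a::real_normed_vector \<Rightarrow> 'b::real_normed_vector"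
  assumes g: "\<And>p. p \<in> S \<Longrightarrow> (g has_derivative g' p) (at p within S)"
    and w: "(w has_vector_derivative d) (at t within I)"
    and I: "t \<in> I" "\<And>t. t \<in> I \<Longrightarrow> (t, w t) \<in> S"
  shows "((\<lambda>t. g (t, w t)) has_vector_derivative g' (t, w t) (1, d)) (at t within I)"
proof -
  have "((\<lambda>t. (t, w t)) has_derivative (\<lambda>h. (h, h *\<^sub>R d))) (at t within I)"
    using w unfolding has_vector_derivative_def by (auto intro!: derivative_eq_intros)
  then have "((\<lambda>t. g (t, w t)) has_derivative (\<lambda>h. g' (t, w t) (h, h *\<^sub>R d))) (at t within I)"
    using has_derivative_in_compose2[of S g g' "\<lambda>t. (t, w t)" I t] g I by blast
  moreover have "g' (t, w t) (h, h *\<^sub>R d) = h *\<^sub>R g' (t, w t) (1, d)" for h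
    using linear_cmul[OF has_derivative_linear[OF g[OF I(2)[OF I(1)]]], of h "(1, d)"] by simp
  ultimately show ?thesis by (simp add: has_vector_derivative_def)
qed

lemma nth_vderiv_chain:
  fixes G :: "nat \<Rightarrow> real \<Rightarrow> real^'d::finite"
  assumes uv: "u < v"
    and der: "\<And>k t. k < n \<Longrightarrow> t \<in> {u..v} \<Longrightarrow>
      (G k has_vector_derivative G (Suc k) t) (at t within {u..v})"
  shows "nth_differentiable n {u..v} (G 0)"
    and "t \<in> {u..v} \<Longrightarrow> nth_vderiv n {u..v} (G 0) t = G n t"
proof -
  have der': "(nth_vderiv k {u..v} (G 0) has_vector_derivative G (Suc k) t) (at t within {u..v})"
    if "\<forall>t\<in>{u..v}. nth_vderiv k {u..v} (G 0) t = G k t" "k < n" "t \<in> {u..v}" for k t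
    using has_vector_derivative_transform[OF that(3) _ der[OF that(2,3)]] that(1) by blast
  have eq: "\<forall>t\<in>{u..v}. nth_vderiv k {u..v} (G 0) t = G k t" if "k \<le> n" for k
    using that
  proof (induction k)
    case 0
    then show ?case by (simp add: nth_vderiv_def)
  next
    case (Suc k)
    then have "\<forall>t\<in>{u..v}. vector_derivative (nth_vderiv k {u..v} (G 0)) (at t within {u..v}) = G (Suc k) t"
      using vector_derivative_within_closed_interval[OF uv _ der'] by auto
    then show ?case by (simp add: nth_vderiv_def)
  qed
  show "nth_differentiable n {u..v} (G 0)"
    unfolding nth_differentiable_def using der' eq less_imp_le differentiableI_vector by metis
  show "t \<in> {u..v} \<Longrightarrow> nth_vderiv n {u..v} (G 0) t = G n t" using eq by blast
qed

section \<open>The local error bound on fine meshes\<close>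

text \<open>A threshold in the number $m$ of steps, for every null sequence \<open>l m\<close>, becomes a threshold
$\delta$ for the step size. If bad meshes of step
at most $1/(n+1)$ exist for all $n$, their sizes \<open>M n\<close> tend to infinity, and \<open>l m\<close> is taken to be
$1/(k+1)$ with $k$ the first index such that \<open>m \<le> M k\<close>: this is a null sequence, and it dominates
the steps of each of the bad meshes.\<close>

lemma fine_mesh_threshold:
  assumes ab: "a < b"
    and P: "\<And>l. decseq l \<Longrightarrow> l \<longlonglongrightarrow> 0 \<Longrightarrow>
      \<exists>m0. \<forall>m\<ge>m0. \<forall>x. mesh a b m x \<and> (\<forall>i<m. x (Suc i) - x i \<le> l m) \<longrightarrow> P m x"
  shows "\<exists>\<delta>>0. \<forall>m x. mesh a b m x \<and> (\<forall>i<m. x (Suc i) - x i \<le> \<delta>) \<longrightarrow> P m x"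
proof (rule ccontr)
  assume "\<not> ?thesis"
  then have "\<exists>m x. mesh a b m x \<and> (\<forall>i<m. x (Suc i) - x i \<le> 1 / real (Suc n)) \<and> \<not> P m x" for n
    by (meson of_nat_0_less_iff zero_less_Suc zero_less_divide_1_iff)
  then obtain M X where X: "\<And>n. mesh a b (M n) (X n)"
      "\<And>n i. i < M n \<Longrightarrow> X n (Suc i) - X n i \<le> 1 / real (Suc n)" "\<And>n. \<not> P (M n) (X n)"
    by metis
  have size: "(b - a) * real (Suc n) \<le> real (M n)" for n
  proof -
    have "b - a = (\<Sum>i<M n. X n (Suc i) - X n i)"
      using X(1)[of n] by (simp add: sum_lessThan_telescope mesh_def)
    also have "\<dots> \<le> (\<Sum>i<M n. 1 / real (Suc n))" using X(2) by (intro sum_mono) auto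
    finally show ?thesis by (simp add: field_simps)
  qed
  have unbounded: "\<exists>n. m \<le> M n" for m
  proof -
    obtain n where "real m / (b - a) < real n" using reals_Archimedean2 by blast
    then have "real m \<le> (b - a) * real (Suc n)" using ab by (simp add: field_simps)
    then show ?thesis using size[of n] by (metis of_nat_le_iff order_trans)
  qed
  define k where "k m = (LEAST n. m \<le> M n)" for m
  define l where "l m = 1 / real (Suc (k m))" for m
  have k: "m \<le> M (k m)" for m unfolding k_def using unbounded by (rule LeastI_ex)
  have "k m \<le> k m'" if "m \<le> m'" for m m'
    unfolding k_def[of m] by (rule Least_le) (use k[of m'] that in linarith)
  then have "decseq l"
    unfolding l_def decseq_def by (intro allI impI divide_left_mono) auto
  moreover have "filterlim k at_top at_top"
    unfolding filterlim_at_top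
  proof
    fix N
    have "N \<le> k m" if "Suc (\<Sum>n<N. M n) \<le> m" for m
    proof (rule ccontr)
      assume "\<not> N \<le> k m"
      then have "M (k m) \<le> (\<Sum>n<N. M n)" by (intro member_le_sum) auto
      with k[of m] that show False by simp
    qed
    then show "\<forall>\<^sub>F m in at_top. N \<le> k m" using eventually_at_top_linorder by blast
  qed
  then have "l \<longlonglongrightarrow> 0"
    unfolding l_def[abs_def] by (rule filterlim_compose[OF LIMSEQ_Suc[OF lim_1_over_n]])
  ultimately obtain m0 where m0: "\<forall>m\<ge>m0. \<forall>x. mesh a b m x \<and> (\<forall>i<m. x (Suc i) - x i \<le> l m) \<longrightarrow> P m x"
    using P by blast
  obtain n where n: "m0 \<le> M n" using unbounded by blast
  have "k (M n) \<le> n" unfolding k_def by (rule Least_le) simp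
  then have "1 / real (Suc n) \<le> l (M n)" unfolding l_def by (intro divide_left_mono) auto
  then have "P (M n) (X n)" using m0 n X(1,2) by (meson order_trans)
  then show False using X(3) by blast
qed

lemma mesh_completion:
  assumes x: "x 0 = a" "\<And>j. j < i \<Longrightarrow> x j < x (Suc j) \<and> x (Suc j) - x j \<le> \<delta>"
    and v: "x i < v" "v - x i \<le> \<delta>" "v \<le> b" and \<delta>: "\<delta> > 0"
  obtains m x' where "mesh a b m x'" "\<forall>k<m. x' (Suc k) - x' k \<le> \<delta>" "i < m"
    "\<forall>j\<le>i. x' j = x j" "x' (Suc i) = v"
proof -
  \<comment> \<open>No uniform steps are added, that is \<open>N = 0\<close>, when \<open>v\<close> is already the end point.\<close>
  obtain N s where N: "v + real N * s = b" "N > 0 \<Longrightarrow> 0 < s \<and> s \<le> \<delta>"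
  proof (cases "v = b")
    case True
    then show thesis using that[of 0 0] by simp
  next
    case False
    obtain N where N: "(b - v) / \<delta> < real N" using reals_Archimedean2 by blast
    moreover have "0 < (b - v) / \<delta>" using False v \<delta> by simp
    ultimately have "real N > 0" by linarith
    then show thesis using N False v \<delta> by (intro that[of N "(b - v) / real N"]) (auto simp: field_simps)
  qed
  define x' where "x' j = (if j \<le> i then x j else v + real (j - Suc i) * s)" for j
  have step: "x' k < x' (Suc k) \<and> x' (Suc k) - x' k \<le> \<delta>" if k: "k < Suc i + N" for k
  proof (cases k i rule: linorder_cases)
    case less
    then show ?thesis using x(2) by (simp add: x'_def)
  next
    case equal
    then show ?thesis using v by (simp add: x'_def)
  next
    case greater
    then have "k - i = Suc (k - Suc i)" by simp
    with greater have "x' (Suc k) - x' k = s" by (simp add: x'_def algebra_simps)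
    then show ?thesis using N(2) k greater by (smt (verit) add_less_cancel_left less_Suc_eq_le not_gr_zero add_0_right leD)
  qed
  show thesis
  proof (rule that)
    show "mesh a b (Suc i + N) x'"
      unfolding mesh_def using step x(1) N(1) by (simp add: x'_def)
    show "\<forall>k<Suc i + N. x' (Suc k) - x' k \<le> \<delta>" using step by blast
  qed (simp_all add: x'_def)
qed

lemma method_value_cong:
  assumes "\<And>j. j \<le> i \<Longrightarrow> x j = x' j"
  shows "method_value \<phi> f \<eta> x i = method_value \<phi> f \<eta> x' i"
  using assms by (induction i) auto

definition local_error_bound ::
    "nat \<Rightarrow> real \<Rightarrow> real \<Rightarrow> 'd::finite ode_method \<Rightarrow> 'd rhs \<Rightarrow> real \<Rightarrow> real \<Rightarrow> real^'d \<Rightarrow> bool" where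
  "local_error_bound r \<beta>bar \<beta> \<phi> f u v y \<longleftrightarrow>
     (\<forall>z. solves_ivp f u v y z \<longrightarrow>
       (SUP t\<in>{u..v}. ereal (infnorm (z t - \<phi> f u v y t)))
         \<le> ereal \<beta>bar * (ereal (1 / fact r) * sup_nth_vderiv (r + 1) {u..v} z + ereal \<beta>)
             * ereal ((v - u) ^ (r + 1)))"

text \<open>A partial mesh, one more trial point, and uniform small steps up to $b$ form a mesh. This makes
the bound available along a run before the run is known to reach $b$, and for the auxiliary steps.\<close>

lemma assumption_A_uniform:
  assumes ab: "a < b" and A: "assumption_A a b \<eta> r \<beta>bar \<beta> \<phi>" and f: "f \<in> F_class a b \<eta> r"
  obtains \<delta> where "\<delta> > 0"
    "\<And>i x v. x 0 = a \<Longrightarrow> (\<And>j. j < i \<Longrightarrow> x j < x (Suc j) \<and> x (Suc j) - x j \<le> \<delta>) \<Longrightarrow>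
       x i < v \<Longrightarrow> v - x i \<le> \<delta> \<Longrightarrow> v \<le> b \<Longrightarrow>
       local_error_bound r \<beta>bar \<beta> \<phi> f (x i) v (method_value \<phi> f \<eta> x i)"
proof -
  let ?P = "\<lambda>m x. \<forall>i<m. local_error_bound r \<beta>bar \<beta> \<phi> f (x i) (x (Suc i)) (method_value \<phi> f \<eta> x i)"
  have "\<exists>\<delta>>0. \<forall>m x. mesh a b m x \<and> (\<forall>i<m. x (Suc i) - x i \<le> \<delta>) \<longrightarrow> ?P m x"
  proof (rule fine_mesh_threshold[OF ab])
    fix l :: "nat \<Rightarrow> real" assume "decseq l" "l \<longlonglongrightarrow> 0"
    then show "\<exists>m0. \<forall>m\<ge>m0. \<forall>x. mesh a b m x \<and> (\<forall>i<m. x (Suc i) - x i \<le> l m) \<longrightarrow> ?P m x"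
      using A[unfolded assumption_A_def, rule_format, OF f, of l 1]
      unfolding Let_def local_error_bound_def mult_1 by blast
  qed
  then obtain \<delta> where \<delta>: "\<delta> > 0"
    "\<And>m x. mesh a b m x \<Longrightarrow> \<forall>i<m. x (Suc i) - x i \<le> \<delta> \<Longrightarrow> ?P m x" by blast
  show thesis
  proof (rule that[OF \<delta>(1)])
    fix i x v
    assume "x 0 = a" "\<And>j. j < i \<Longrightarrow> x j < x (Suc j) \<and> x (Suc j) - x j \<le> \<delta>"
      "x i < v" "v - x i \<le> \<delta>" "v \<le> b"
    then obtain m x' where x': "mesh a b m x'" "\<forall>k<m. x' (Suc k) - x' k \<le> \<delta>" "i < m"
        "\<forall>j\<le>i. x' j = x j" "x' (Suc i) = v"
      using mesh_completion[of x a i \<delta> v b] \<delta>(1) by metis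
    moreover have "method_value \<phi> f \<eta> x' i = method_value \<phi> f \<eta> x i"
      using x'(4) by (intro method_value_cong) auto
    ultimately show "local_error_bound r \<beta>bar \<beta> \<phi> f (x i) v (method_value \<phi> f \<eta> x i)"
      using \<delta>(2)[OF x'(1,2)] by force
  qed
qed

section \<open>Solutions in a tube around the global solution\<close>

text \<open>\<open>F j\<close> is the $j$-th derivative of $f$ along its own flow, so that it maps \<open>(t, w t)\<close> to the derivative of
order $j+1$ of a solution $w$. The set \<open>S\<close> stands for the compact body on which $f$ is smooth; what
matters is that it contains the tube of radius 1 around the global solution. All constants refer to
the Euclidean norm, and the maximum norm enters only through its equivalence with that norm.\<close>

locale solution_tube =
  fixes a b L M :: real and \<eta> :: "real^'d::finite" and r :: nat and f :: "'d rhs"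
    and z :: "real \<Rightarrow> real^'d" and S :: "(real \<times> (real^'d)) set"
    and F :: "nat \<Rightarrow> real \<times> (real^'d) \<Rightarrow> real^'d"
  assumes ab: "a < b" and L0: "0 \<le> L"
    and cont: "continuous_on ({a..b} \<times> UNIV) (\<lambda>(t, y). f t y)"
    and lip: "\<And>t y y'. t \<in> {a..b} \<Longrightarrow> norm (f t y - f t y') \<le> L * norm (y - y')"
    and sol: "solves_ivp f a b \<eta> z"
    and F0: "\<And>t y. F 0 (t, y) = f t y"
    and F_Suc: "\<And>j. j < r \<Longrightarrow>
      \<exists>D. \<forall>p\<in>S. (F j has_derivative D p) (at p within S) \<and> F (Suc j) p = D p (1, F 0 p)"
    and S: "\<And>t y. t \<in> {a..b} \<Longrightarrow> norm (y - z t) \<le> 1 \<Longrightarrow> (t, y) \<in> S"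
    and M: "\<And>p. p \<in> S \<Longrightarrow> norm (F 0 p) \<le> M" "\<And>p. p \<in> S \<Longrightarrow> norm (F r p) \<le> M"
begin

lemma M_nonneg: "0 \<le> M"
proof -
  have "(a, z a) \<in> S" using ab by (intro S) auto
  then show ?thesis using M(1) norm_ge_zero order_trans by blast
qed

context
  fixes u v :: real and y :: "real^'d" and w :: "real \<Rightarrow> real^'d"
  assumes uv: "a \<le> u" "u < v" "v \<le> b" and short: "L * (v - u) \<le> 1/2"
    and near: "norm (y - z u) \<le> 1/2"
begin

lemma local_solution_exists: "\<exists>w. solves_ivp f u v y w"
  by (rule lipschitz_solution_exists[OF less_imp_le[OF uv(2)] continuous_on_subset[OF cont] lip L0 short])
    (use uv in auto)

context
  assumes w: "solves_ivp f u v y w"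
begin

lemma local_solution_near:
  assumes t: "t \<in> {u..v}"
  shows "norm (w t - z t) \<le> (1 + 2 * L * (v - u)) * norm (y - z u)"
  by (rule lipschitz_solution_stability[OF less_imp_le[OF uv(2)] lip L0 short w
      solves_ivp_subinterval[OF sol uv(1,3)] t])
    (use uv in auto)

lemma local_solution_in_S:
  assumes t: "t \<in> {u..v}"
  shows "(t, w t) \<in> S"
proof (rule S)
  have "1 + 2 * L * (v - u) \<le> 2" using short by linarith
  then have "(1 + 2 * L * (v - u)) * norm (y - z u) \<le> 2 * (1/2)"
    by (rule mult_mono[OF _ near]) simp_all
  then show "norm (w t - z t) \<le> 1" using local_solution_near[OF t] by linarith
qed (use t uv in auto)

lemma local_solution_init: "w u = y"
  using w by (simp add: solves_ivp_def)

lemma local_solution_deriv: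
  assumes "t \<in> {u..v}"
  shows "(w has_vector_derivative F 0 (t, w t)) (at t within {u..v})"
  using w assms by (simp add: solves_ivp_def F0)

lemma local_solution_increment:
  assumes t: "t \<in> {u..v}"
  shows "norm (w t - y) \<le> M * (v - u)"
proof -
  have "norm (w t - w u - (t - u) *\<^sub>R 0) \<le> M * \<bar>t - u\<bar>"
  proof (rule vector_derivative_increment_bound[OF local_solution_deriv])
    fix t assume "t \<in> {u..v}"
    then show "norm (F 0 (t, w t) - 0) \<le> M" using M(1)[OF local_solution_in_S] by simp
  qed (use t uv in auto)
  also have "\<dots> \<le> M * (v - u)" by (rule mult_left_mono[OF _ M_nonneg]) (use t in auto)
  finally show ?thesis by (simp add: local_solution_init)
qed

lemma local_solution_F_deriv:
  assumes j: "j < r" and t: "t \<in> {u..v}"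
  shows "((\<lambda>t. F j (t, w t)) has_vector_derivative F (Suc j) (t, w t)) (at t within {u..v})"
proof -
  obtain D where D: "\<And>p. p \<in> S \<Longrightarrow> (F j has_derivative D p) (at p within S)"
    "\<And>p. p \<in> S \<Longrightarrow> F (Suc j) p = D p (1, F 0 p)"
    using F_Suc[OF j] by blast
  show ?thesis
    unfolding D(2)[OF local_solution_in_S[OF t]]
    by (rule has_vector_derivative_along_graph[where S = S, OF D(1) local_solution_deriv[OF t] t local_solution_in_S])
qed

lemma local_solution_sup_nth_vderiv:
  "sup_nth_vderiv (r + 1) {u..v} w = (SUP t\<in>{u..v}. ereal (infnorm (F r (t, w t))))"
proof -
  let ?G = "case_nat w (\<lambda>j t. F j (t, w t))"
  have der: "(?G k has_vector_derivative ?G (Suc k) t) (at t within {u..v})"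
    if "k < Suc r" "t \<in> {u..v}" for k t
    using that local_solution_deriv local_solution_F_deriv by (cases k) auto
  from nth_vderiv_chain[OF uv(2), of "Suc r" ?G, OF der]
  show ?thesis by (auto simp: sup_nth_vderiv_def intro!: SUP_cong)
qed

lemma local_error_le:
  assumes leb: "local_error_bound r \<beta>bar \<beta> \<phi> f u v y" and bb: "\<beta>bar > 0"
    and B: "\<And>t. t \<in> {u..v} \<Longrightarrow> infnorm (F r (t, w t)) \<le> B"
  shows "(SUP t\<in>{u..v}. ereal (infnorm (w t - \<phi> f u v y t)))
    \<le> ereal (\<beta>bar * (B / fact r + \<beta>) * (v - u) ^ (r + 1))"
proof -
  have "sup_nth_vderiv (r + 1) {u..v} w \<le> ereal B"
    unfolding local_solution_sup_nth_vderiv by (intro SUP_least) (simp add: B)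
  then have "ereal \<beta>bar * (ereal (1 / fact r) * sup_nth_vderiv (r + 1) {u..v} w + ereal \<beta>)
        * ereal ((v - u) ^ (r + 1))
      \<le> ereal \<beta>bar * (ereal (1 / fact r) * ereal B + ereal \<beta>) * ereal ((v - u) ^ (r + 1))"
    using bb uv by (intro ereal_mult_right_mono ereal_mult_left_mono add_right_mono) auto
  then show ?thesis
    using leb[unfolded local_error_bound_def, rule_format, OF w] by (simp add: order_trans)
qed

text \<open>The factor \<open>sqrt DIM\<close> is the price for passing from the maximum norm to the Euclidean one.\<close>

lemma local_error_norm_le:
  assumes leb: "local_error_bound r \<beta>bar \<beta> \<phi> f u v y" and bb: "\<beta>bar > 0" and t: "t \<in> {u..v}"
  shows "norm (w t - \<phi> f u v y t)
    \<le> sqrt DIM(real^'d) * (\<beta>bar * (M / fact r + \<beta>)) * (v - u) ^ (r + 1)"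
proof -
  have "infnorm (F r (t, w t)) \<le> M" if "t \<in> {u..v}" for t
    using M(2)[OF local_solution_in_S[OF that]] infnorm_le_norm order_trans by blast
  from local_error_le[OF leb bb this]
  have "infnorm (w t - \<phi> f u v y t) \<le> \<beta>bar * (M / fact r + \<beta>) * (v - u) ^ (r + 1)"
    using t by (simp add: SUP_le_iff)
  then have "sqrt DIM(real^'d) * infnorm (w t - \<phi> f u v y t)
      \<le> sqrt DIM(real^'d) * (\<beta>bar * (M / fact r + \<beta>) * (v - u) ^ (r + 1))"
    by (intro mult_left_mono) auto
  then show ?thesis
    using norm_le_infnorm[of "w t - \<phi> f u v y t"] by (simp only: mult.assoc)
qed

lemma local_F_oscillation:
  assumes osc: "\<And>p q. p \<in> S \<Longrightarrow> q \<in> S \<Longrightarrow> dist p q \<le> (1 + M) * (v - u) \<Longrightarrow> norm (F r p - F r q) \<le> \<omega>"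
    and t: "t \<in> {u..v}"
  shows "norm (F r (t, w t) - F r (u, y)) \<le> \<omega>"
proof (rule osc)
  show "(u, y) \<in> S" using local_solution_in_S[of u] uv by (simp add: local_solution_init)
  have "dist (t, w t) (u, y) \<le> dist t u + dist (w t) y"
    unfolding dist_Pair_Pair by (rule sqrt_sum_squares_le_sum) auto
  also have "\<dots> \<le> (v - u) + M * (v - u)"
    using t local_solution_increment[OF t] by (simp add: dist_norm)
  finally show "dist (t, w t) (u, y) \<le> (1 + M) * (v - u)" by (simp add: algebra_simps)
qed (rule local_solution_in_S[OF t])

text \<open>The divided difference of \<open>t \<mapsto> f t (w t)\<close>, the first derivative of the local solution, is close to
\<open>F r (u, y) / r!\<close>. Replacing $w$ by its approximation changes the data by order $(v-u)^{r+1}$,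
while the divided difference amplifies this only by a factor of order $(v-u)^{-r}$.\<close>

lemma trial_divided_diff:
  assumes leb: "local_error_bound r \<beta>bar \<beta> \<phi> f u v y" and bb: "\<beta>bar > 0" and r: "r \<ge> 1"
    and osc: "\<And>p q. p \<in> S \<Longrightarrow> q \<in> S \<Longrightarrow> dist p q \<le> (1 + M) * (v - u) \<Longrightarrow> norm (F r p - F r q) \<le> \<omega>"
  shows "norm (divided_diff (\<lambda>t. f t (\<phi> f u v y t)) (\<lambda>j. u + real j * (v - u) / real r) 0 r
      - F r (u, y) /\<^sub>R fact r)
    \<le> \<omega> + (2 * real r) ^ r * L * (sqrt DIM(real^'d) * (\<beta>bar * (M / fact r + \<beta>))) * (v - u)"
proof -
  let ?C = "sqrt DIM(real^'d) * (\<beta>bar * (M / fact r + \<beta>))"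
  let ?n = "\<lambda>j. u + real j * (v - u) / real r"
  define s where "s = (v - u) / real r"
  have n: "?n j = u + real j * s" for j by (simp add: s_def)
  have s: "s > 0" and rs: "u + real r * s \<le> v" using r uv by (auto simp: s_def)
  let ?H = "\<lambda>t. F 0 (t, w t)" and ?E = "\<lambda>t. f t (\<phi> f u v y t) - f t (w t)"
  have \<omega>: "norm (F r (t, w t) - F r (u, y)) \<le> \<omega>" if "t \<in> {u..v}" for t
    using local_F_oscillation[OF osc that] by simp
  have "0 \<le> \<omega>" using \<omega>[of u] uv norm_ge_zero order_trans by (metis atLeastAtMost_iff less_imp_le order_refl)
  have "norm (divided_diff ?H ?n 0 r - F r (u, y) /\<^sub>R fact r) \<le> \<omega> / fact r"
    by (rule divided_diff_near_derivative[OF n s rs local_solution_F_deriv \<omega>])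
  also have "\<dots> \<le> \<omega> / 1" using \<open>0 \<le> \<omega>\<close> by (intro divide_left_mono) (auto simp: fact_ge_1)
  finally have main: "norm (divided_diff ?H ?n 0 r - F r (u, y) /\<^sub>R fact r) \<le> \<omega>" by simp
  have "norm (divided_diff ?E ?n 0 r) \<le> (2 / s) ^ r * (L * (?C * (v - u) ^ (r + 1)))"
  proof (rule divided_diff_bound[OF n s])
    fix j assume "0 \<le> j" "j \<le> 0 + r"
    then have "real j * s \<le> real r * s" "0 \<le> real j * s"
      using s by (auto intro!: mult_right_mono)
    then have t: "?n j \<in> {u..v}" unfolding n using rs by auto
    have "norm (?E (?n j)) \<le> L * norm (\<phi> f u v y (?n j) - w (?n j))"
    proof (rule lip)
      show "?n j \<in> {a..b}" using t uv by (meson atLeastAtMost_iff order_trans)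
    qed
    also have "\<dots> \<le> L * (?C * (v - u) ^ (r + 1))"
      using local_error_norm_le[OF leb bb t] L0 by (intro mult_left_mono) (auto simp: norm_minus_commute)
    finally show "norm (?E (?n j)) \<le> L * (?C * (v - u) ^ (r + 1))" .
  qed
  also have "(2 / s) ^ r * (L * (?C * (v - u) ^ (r + 1))) = (2 / s * (v - u)) ^ r * L * ?C * (v - u)"
    by (simp only: power_mult_distrib power_add power_one_right mult_ac)
  also have "2 / s * (v - u) = 2 * real r" using uv r by (simp add: s_def)
  finally have pert: "norm (divided_diff ?E ?n 0 r) \<le> (2 * real r) ^ r * L * ?C * (v - u)" .
  have "(\<lambda>t. f t (\<phi> f u v y t) - f t (w t)) = (\<lambda>t. f t (\<phi> f u v y t) - ?H t)" by (simp add: F0)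
  then have split: "divided_diff (\<lambda>t. f t (\<phi> f u v y t)) ?n 0 r
      = divided_diff ?E ?n 0 r + divided_diff ?H ?n 0 r"
    by (simp only: divided_diff_diff diff_add_cancel)
  show ?thesis
    unfolding split add_diff_eq[symmetric]
    using norm_triangle_ineq[of "divided_diff ?E ?n 0 r" "divided_diff ?H ?n 0 r - F r (u, y) /\<^sub>R fact r"]
      main pert by linarith
qed

end
end

end

section \<open>The adaptive mesh\<close>

text \<open>The parameters below are those of one run, with the threshold $\delta$ so small that every
error term is absorbed by the factor $4/3$ and by the unit margin of the tube.\<close>

locale adaptive_run = solution_tube a b L M \<eta> r f z S F
  for a b L M :: real and \<eta> :: "real^'d::finite" and r :: nat and f :: "'d rhs"
    and z :: "real \<Rightarrow> real^'d" and S :: "(real \<times> (real^'d)) set"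
    and F :: "nat \<Rightarrow> real \<times> (real^'d) \<Rightarrow> real^'d" +
  fixes \<phi> :: "'d ode_method" and \<beta>bar \<beta> \<kappa> \<epsilon> \<delta> C :: real and h :: "real \<Rightarrow> real"
  assumes r: "r \<ge> 1" and bb: "\<beta>bar > 0" and \<beta>: "\<beta> > 0" and \<kappa>: "\<kappa> > 0"
    and C: "C = sqrt DIM(real^'d) * (\<beta>bar * (M / fact r + \<beta>))"
    and leb: "\<And>i x v. x 0 = a \<Longrightarrow> (\<And>j. j < i \<Longrightarrow> x j < x (Suc j) \<and> x (Suc j) - x j \<le> \<delta>) \<Longrightarrow>
       x i < v \<Longrightarrow> v - x i \<le> \<delta> \<Longrightarrow> v \<le> b \<Longrightarrow>
       local_error_bound r \<beta>bar \<beta> \<phi> f (x i) v (method_value \<phi> f \<eta> x i)"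
    and \<delta>: "\<delta> > 0" "\<delta> \<le> 1" "L * \<delta> \<le> 1/2"
    and \<delta>_tube: "C * \<delta> * (b - a) * exp (2 * L * (b - a)) \<le> 1/2"
    and \<delta>_osc: "\<And>p q. p \<in> S \<Longrightarrow> q \<in> S \<Longrightarrow> dist p q \<le> (1 + M) * \<delta> \<Longrightarrow> norm (F r p - F r q) \<le> \<beta> / 9"
    and \<delta>_pert: "(2 * real r) ^ r * L * C * \<delta> \<le> \<beta> / 9"
    and \<epsilon>: "\<epsilon> > 0" "(\<epsilon> / (4 / 3 * \<beta>bar * \<beta>)) powr (1 / real (r + 1)) \<le> \<delta>"
    and h: "h \<epsilon> > 0" "h \<epsilon> \<le> \<delta>"
begin

lemma C_nonneg: "0 \<le> C"
  unfolding C using bb \<beta> M_nonneg by simp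

lemma short: "v - u \<le> \<delta> \<Longrightarrow> L * (v - u) \<le> 1/2"
  using mult_left_mono[OF _ L0, of "v - u" \<delta>] \<delta>(3) by linarith

text \<open>The local errors are $O(\delta (x_{i+1}-x_i))$ because $r \ge 1$; they add up to $O(\delta)$, up to
the stability factor $\exp(2L(b-a))$.\<close>

lemma method_value_near:
  assumes x: "x 0 = a" "\<And>j. j < n \<Longrightarrow> x j < x (Suc j) \<and> x (Suc j) - x j \<le> \<delta>"
      "\<And>j. j \<le> n \<Longrightarrow> x j \<le> b"
    and i: "i \<le> n"
  shows "a \<le> x i \<and> norm (method_value \<phi> f \<eta> x i - z (x i)) \<le> 1/2"
proof -
  let ?y = "method_value \<phi> f \<eta> x"
  let ?e = "\<lambda>s. C * \<delta> * (s - a) * exp (2 * L * (s - a))"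
  have e: "?e s \<le> 1/2" if "a \<le> s" "s \<le> b" for s
  proof -
    have "?e s \<le> C * \<delta> * (b - a) * exp (2 * L * (b - a))"
      using that C_nonneg \<delta>(1) L0 by (intro mult_mono mult_left_mono) (auto simp: mult_left_mono)
    then show ?thesis using \<delta>_tube by linarith
  qed
  have "a \<le> x i \<and> norm (?y i - z (x i)) \<le> ?e (x i)"
    using i
  proof (induction i)
    case 0
    then show ?case using x(1) sol by (simp add: solves_ivp_def)
  next
    case (Suc i)
    let ?u = "x i" and ?v = "x (Suc i)"
    from Suc have u: "a \<le> ?u" "norm (?y i - z ?u) \<le> ?e ?u" by auto
    have v: "?u < ?v" "?v - ?u \<le> \<delta>" "?v \<le> b" using x(2)[of i] x(3)[of "Suc i"] Suc.prems by auto
    have near: "norm (?y i - z ?u) \<le> 1/2" using u e[of ?u] v by linarith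
    obtain w where w: "solves_ivp f ?u ?v (?y i) w"
      using local_solution_exists[OF u(1) v(1,3) short[OF v(2)] near] by blast
    have lebi: "local_error_bound r \<beta>bar \<beta> \<phi> f ?u ?v (?y i)"
      by (rule leb) (use x v Suc.prems in auto)
    have "norm (w ?v - ?y (Suc i)) \<le> C * (?v - ?u) ^ (r + 1)"
      using local_error_norm_le[OF u(1) v(1,3) short[OF v(2)] near w lebi bb, of ?v] v by (simp add: C)
    also have "\<dots> \<le> C * (\<delta> * (?v - ?u))"
    proof -
      have "(?v - ?u) ^ r \<le> (?v - ?u) ^ 1"
        using v \<delta>(2) r by (intro power_decreasing) auto
      then have "(?v - ?u) ^ r * (?v - ?u) \<le> \<delta> * (?v - ?u)"
        using v by (intro mult_right_mono) auto
      then show ?thesis using C_nonneg by (intro mult_left_mono) (auto simp: mult.commute)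
    qed
    finally have 1: "norm (w ?v - ?y (Suc i)) \<le> C * \<delta> * (?v - ?u)" by simp
    have "norm (w ?v - z ?v) \<le> (1 + 2 * L * (?v - ?u)) * norm (?y i - z ?u)"
      by (rule local_solution_near[OF u(1) v(1,3) short[OF v(2)] near w]) (use v in auto)
    also have "\<dots> \<le> exp (2 * L * (?v - ?u)) * ?e ?u"
      using u L0 v by (intro mult_mono exp_ge_add_one_self) auto
    also have "\<dots> = C * \<delta> * (?u - a) * exp (2 * L * (?v - a))"
      by (simp add: exp_add[symmetric] algebra_simps)
    finally have 2: "norm (w ?v - z ?v) \<le> C * \<delta> * (?u - a) * exp (2 * L * (?v - a))" .
    have "C * \<delta> * (?v - ?u) * 1 \<le> C * \<delta> * (?v - ?u) * exp (2 * L * (?v - a))"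
      using C_nonneg \<delta>(1) v u L0 by (intro mult_left_mono) auto
    with 1 2 have "norm (w ?v - ?y (Suc i)) + norm (w ?v - z ?v) \<le> ?e ?v"
      by (simp add: algebra_simps)
    moreover have "norm (?y (Suc i) - z ?v) \<le> norm (w ?v - ?y (Suc i)) + norm (w ?v - z ?v)"
      using norm_triangle_ineq4[of "w ?v - z ?v" "w ?v - ?y (Suc i)"] by (simp add: algebra_simps)
    ultimately show ?case using u v by linarith
  qed
  then show ?thesis using e[of "x i"] x(3)[OF i] by linarith
qed

abbreviation G where "G \<equiv> adapt_G \<phi> b r \<beta>bar \<beta> \<kappa> h f \<epsilon>"

lemma le_times_safety_factor: "(4 / 3) * \<beta>bar * (p + \<beta>) \<le> 4 / 3 * \<beta>bar * (p + \<beta>) * (1 + \<kappa>)" if "p \<ge> 0" for p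
  using that bb \<beta> \<kappa> by (intro order_trans[OF eq_refl[OF mult_1_right[symmetric]] mult_left_mono]) auto

lemma G_lower: "4 / 3 * \<beta>bar * \<beta> \<le> G u y"
proof -
  have "4 / 3 * \<beta>bar * \<beta> \<le> 4 / 3 * \<beta>bar * (p + \<beta>)" if "p \<ge> 0" for p
    using that bb by (intro mult_left_mono) auto
  from order_trans[OF this le_times_safety_factor] show ?thesis
    unfolding adapt_G_def Let_def using infnorm_pos_le by blast
qed

lemma G_pos: "0 < G u y"
  using G_lower[of u y] bb \<beta> by (smt (verit) mult_pos_pos divide_pos_pos)

lemma step_pos: "0 < (\<epsilon> / G u y) powr (1 / real (r + 1))"
  using \<epsilon>(1) G_pos[of u y] by simp

lemma step_le: "(\<epsilon> / G u y) powr (1 / real (r + 1)) \<le> \<delta>"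
proof -
  have "\<epsilon> / G u y \<le> \<epsilon> / (4 / 3 * \<beta>bar * \<beta>)"
    using G_lower[of u y] G_pos[of u y] \<epsilon>(1) bb \<beta> by (intro divide_left_mono) auto
  then have "(\<epsilon> / G u y) powr (1 / real (r + 1)) \<le> (\<epsilon> / (4 / 3 * \<beta>bar * \<beta>)) powr (1 / real (r + 1))"
    using \<epsilon>(1) G_pos[of u y] by (intro powr_mono2) auto
  then show ?thesis using \<epsilon>(2) by linarith
qed

text \<open>\<open>F r (u, y)\<close> is the derivative of order $r+1$ at $u$ of the local solution through \<open>(u, y)\<close>.\<close>

lemma G_near_derivative:
  assumes u: "a \<le> u" "u < b" and near: "norm (y - z u) \<le> 1/2"
    and lebu: "\<And>v. u < v \<Longrightarrow> v - u \<le> \<delta> \<Longrightarrow> v \<le> b \<Longrightarrow> local_error_bound r \<beta>bar \<beta> \<phi> f u v y"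
  shows "\<exists>d. G u y = 4 / 3 * \<beta>bar * (infnorm d + \<beta>) * (1 + \<kappa>) \<and>
    norm (d - F r (u, y) /\<^sub>R fact r) \<le> 2 * \<beta> / 9"
proof -
  define v where "v = u + min (h \<epsilon>) (b - u)"
  have v: "u < v" "v \<le> b" "v - u \<le> \<delta>" using u h by (auto simp: v_def)
  obtain w where w: "solves_ivp f u v y w"
    using local_solution_exists[OF u(1) v(1,2) short[OF v(3)] near] by blast
  let ?d = "divided_diff (\<lambda>t. f t (\<phi> f u v y t)) (\<lambda>j. u + real j * (v - u) / real r) 0 r"
  have "norm (?d - F r (u, y) /\<^sub>R fact r) \<le> \<beta> / 9 + (2 * real r) ^ r * L * C * (v - u)"
    unfolding C
  proof (rule trial_divided_diff[OF u(1) v(1,2) short[OF v(3)] near w lebu[OF v(1,3,2)] bb r])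
    fix p q assume "p \<in> S" "q \<in> S" and d: "dist p q \<le> (1 + M) * (v - u)"
    moreover have "(1 + M) * (v - u) \<le> (1 + M) * \<delta>" using v M_nonneg by (intro mult_left_mono) auto
    ultimately show "norm (F r p - F r q) \<le> \<beta> / 9" by (intro \<delta>_osc) auto
  qed
  also have "(2 * real r) ^ r * L * C * (v - u) \<le> (2 * real r) ^ r * L * C * \<delta>"
    using v L0 C_nonneg by (intro mult_left_mono) auto
  finally have "norm (?d - F r (u, y) /\<^sub>R fact r) \<le> 2 * \<beta> / 9" using \<delta>_pert by linarith
  moreover have "G u y = 4 / 3 * \<beta>bar * (infnorm ?d + \<beta>) * (1 + \<kappa>)"
    unfolding adapt_G_def Let_def v_def by simp
  ultimately show ?thesis by blast
qed

lemma infnorm_diff_le: "norm (p - q) \<le> c \<Longrightarrow> infnorm p \<le> infnorm q + c" for p q :: "real^'d"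
  using infnorm_le_norm[of "p - q"] infnorm_triangle[of q "p - q"] by simp

lemma G_upper:
  assumes u: "a \<le> u" "u < b" and near: "norm (y - z u) \<le> 1/2"
    and lebu: "\<And>v. u < v \<Longrightarrow> v - u \<le> \<delta> \<Longrightarrow> v \<le> b \<Longrightarrow> local_error_bound r \<beta>bar \<beta> \<phi> f u v y"
  shows "G u y \<le> 4 / 3 * \<beta>bar * (M + 2 * \<beta>) * (1 + \<kappa>)"
proof -
  obtain d where d: "G u y = 4 / 3 * \<beta>bar * (infnorm d + \<beta>) * (1 + \<kappa>)"
    "norm (d - F r (u, y) /\<^sub>R fact r) \<le> 2 * \<beta> / 9"
    using G_near_derivative[OF assms] by blast
  have "norm (F r (u, y)) \<le> M" by (rule M(2)[OF S]) (use u near in auto)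
  then have "infnorm (F r (u, y) /\<^sub>R fact r) \<le> M / fact r"
    using infnorm_le_norm[of "F r (u, y)"] by (simp add: infnorm_mul divide_simps mult.commute)
  also have "\<dots> \<le> M / 1" using M_nonneg by (intro divide_left_mono) (auto simp: fact_ge_1)
  finally have "infnorm d + \<beta> \<le> M + 2 * \<beta>" using infnorm_diff_le[OF d(2)] \<beta> by linarith
  then show ?thesis unfolding d(1) using bb \<kappa> by (intro mult_right_mono mult_left_mono) auto
qed

text \<open>All values of the derivative of order $r+1$ over the step differ from the one seen by the divided
difference by at most $\beta/3$ in total, which the factor $4/3$ absorbs.\<close>

lemma step_error:
  assumes u: "a \<le> u" and v: "u < v" "v \<le> b" "v - u \<le> (\<epsilon> / G u y) powr (1 / real (r + 1))"
    and near: "norm (y - z u) \<le> 1/2"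
    and lebu: "\<And>v. u < v \<Longrightarrow> v - u \<le> \<delta> \<Longrightarrow> v \<le> b \<Longrightarrow> local_error_bound r \<beta>bar \<beta> \<phi> f u v y"
    and w: "solves_ivp f u v y w"
  shows "(SUP t\<in>{u..v}. ereal (infnorm (w t - \<phi> f u v y t))) \<le> ereal \<epsilon>"
proof -
  have v\<delta>: "v - u \<le> \<delta>" using v(3) step_le order_trans by blast
  obtain d where d: "G u y = 4 / 3 * \<beta>bar * (infnorm d + \<beta>) * (1 + \<kappa>)"
    "norm (d - F r (u, y) /\<^sub>R fact r) \<le> 2 * \<beta> / 9"
    using G_near_derivative[OF u _ near lebu] v by auto
  define B where "B = infnorm (F r (u, y)) + \<beta> / 9"
  have B: "infnorm (F r (t, w t)) \<le> B" if t: "t \<in> {u..v}" for t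
    unfolding B_def
  proof (rule infnorm_diff_le[OF local_F_oscillation[OF u v(1,2) short[OF v\<delta>] near w _ t]])
    fix p q assume "p \<in> S" "q \<in> S" and d: "dist p q \<le> (1 + M) * (v - u)"
    moreover have "(1 + M) * (v - u) \<le> (1 + M) * \<delta>" using v\<delta> M_nonneg by (intro mult_left_mono) auto
    ultimately show "norm (F r p - F r q) \<le> \<beta> / 9" by (intro \<delta>_osc) auto
  qed
  define c where "c = \<beta> / 9 / fact r"
  define q where "q = infnorm (F r (u, y) /\<^sub>R fact r)"
  have Bq: "B / fact r = q + c"
    by (simp add: B_def c_def q_def infnorm_mul field_simps)
  have "c \<le> \<beta> / 9 / 1"
    unfolding c_def using \<beta> by (intro divide_left_mono) (auto simp: fact_ge_1)
  moreover have "q \<le> infnorm d + 2 * \<beta> / 9"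
    unfolding q_def using d(2) by (intro infnorm_diff_le) (simp add: norm_minus_commute)
  ultimately have "B / fact r + \<beta> \<le> 4 / 3 * (infnorm d + \<beta>)"
    unfolding Bq using infnorm_pos_le[of d] by simp
  then have "\<beta>bar * (B / fact r + \<beta>) \<le> \<beta>bar * (4 / 3 * (infnorm d + \<beta>))"
    using bb by (intro mult_left_mono) auto
  also have "\<dots> \<le> G u y" unfolding d(1) using le_times_safety_factor[OF infnorm_pos_le, of d] by (simp add: mult.commute mult.left_commute)
  finally have "\<beta>bar * (B / fact r + \<beta>) * (v - u) ^ (r + 1) \<le> G u y * (v - u) ^ (r + 1)"
    using v by (intro mult_right_mono) auto
  also have "\<dots> \<le> G u y * (\<epsilon> / G u y)"
  proof (rule mult_left_mono)
    have "(v - u) ^ (r + 1) \<le> ((\<epsilon> / G u y) powr (1 / real (r + 1))) ^ (r + 1)"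
      using v by (intro power_mono) auto
    also have "\<dots> = \<epsilon> / G u y"
      using \<epsilon>(1) G_pos[of u y] by (subst powr_realpow[symmetric]) (auto simp: powr_powr)
    finally show "(v - u) ^ (r + 1) \<le> \<epsilon> / G u y" .
  qed (rule less_imp_le[OF G_pos])
  also have "\<dots> = \<epsilon>" using G_pos[of u y] by simp
  finally show ?thesis
    using local_error_le[OF u v(1,2) short[OF v\<delta>] near w lebu[OF v(1) v\<delta> v(2)] bb B]
    by (meson ereal_less_eq(3) order_trans)
qed

definition run_prefix :: "nat \<Rightarrow> (nat \<Rightarrow> real) \<Rightarrow> (nat \<Rightarrow> real^'d) \<Rightarrow> bool" where
  "run_prefix n x y \<longleftrightarrow> x 0 = a \<and> y 0 = \<eta> \<and>
     (\<forall>i<n. x i < b \<and>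
        x (Suc i) = x i + min ((\<epsilon> / G (x i) (y i)) powr (1 / real (r + 1))) (b - x i) \<and>
        y (Suc i) = \<phi> f (x i) (x (Suc i)) (y i) (x (Suc i)))"

lemma adapt_mesh_gen_iff_run_prefix:
  "adapt_mesh_gen \<phi> a b \<eta> r \<beta>bar \<beta> \<kappa> h f \<epsilon> m x y \<longleftrightarrow> run_prefix m x y \<and> x m = b"
  by (auto simp: adapt_mesh_gen_def run_prefix_def)

context
  fixes n x y
  assumes run: "run_prefix n x y"
begin

lemma run_start: "x 0 = a" "y 0 = \<eta>"
  and run_lt: "i < n \<Longrightarrow> x i < b"
  and run_x: "i < n \<Longrightarrow> x (Suc i) = x i + min ((\<epsilon> / G (x i) (y i)) powr (1 / real (r + 1))) (b - x i)"
  and run_y: "i < n \<Longrightarrow> y (Suc i) = \<phi> f (x i) (x (Suc i)) (y i) (x (Suc i))"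
  using run unfolding run_prefix_def by blast+

lemma run_method_value: "i \<le> n \<Longrightarrow> y i = method_value \<phi> f \<eta> x i"
  by (induction i) (simp_all add: run_start run_y)

lemma run_step: "i < n \<Longrightarrow> x i < x (Suc i) \<and> x (Suc i) - x i \<le> \<delta>"
  using run_lt[of i] run_x[of i] step_pos[of "x i" "y i"] step_le[of "x i" "y i"]
  by (simp add: min_def)

lemma run_le: "i \<le> n \<Longrightarrow> x i \<le> b"
  using ab run_x[of "i - 1"] by (cases i) (auto simp: run_start min_def)

lemma run_near:
  assumes "i \<le> n"
  shows "a \<le> x i" "norm (y i - z (x i)) \<le> 1/2"
  using method_value_near[OF run_start(1) run_step run_le assms] run_method_value[OF assms] by auto

lemma run_local_error_bound:
  "i \<le> n \<Longrightarrow> x i < v \<Longrightarrow> v - x i \<le> \<delta> \<Longrightarrow> v \<le> b \<Longrightarrow> local_error_bound r \<beta>bar \<beta> \<phi> f (x i) v (y i)"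
  using leb[of x i v] run_start(1) run_step run_method_value[of i] by simp

end

lemma run_correct:
  assumes "adapt_mesh_gen \<phi> a b \<eta> r \<beta>bar \<beta> \<kappa> h f \<epsilon> m x y"
  shows "mesh a b m x" and "i < m \<Longrightarrow> solves_ivp f (x i) (x (Suc i)) (y i) w \<Longrightarrow>
    (SUP t\<in>{x i..x (Suc i)}. ereal (infnorm (w t - \<phi> f (x i) (x (Suc i)) (y i) t))) \<le> ereal \<epsilon>"
proof -
  have run: "run_prefix m x y" and end_b: "x m = b"
    using assms by (auto simp: adapt_mesh_gen_iff_run_prefix)
  show "mesh a b m x"
    unfolding mesh_def using run_start(1)[OF run] end_b run_step[OF run] by blast
  assume i: "i < m" and w: "solves_ivp f (x i) (x (Suc i)) (y i) w"
  show "(SUP t\<in>{x i..x (Suc i)}. ereal (infnorm (w t - \<phi> f (x i) (x (Suc i)) (y i) t))) \<le> ereal \<epsilon>"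
  proof (rule step_error[OF run_near(1)[OF run] _ _ _ run_near(2)[OF run] run_local_error_bound[OF run] w])
    show "x i < x (Suc i)" using run_step[OF run i] by blast
    show "x (Suc i) \<le> b" using run_le[OF run, of "Suc i"] i by simp
    show "x (Suc i) - x i \<le> (\<epsilon> / G (x i) (y i)) powr (1 / real (r + 1))"
      using run_x[OF run i] by simp
  qed (use i in auto)
qed

text \<open>The quantities $G_i$ are bounded along a run, hence steps that do not reach $b$ are bounded below.\<close>

lemma run_exists: "\<exists>m x y. adapt_mesh_gen \<phi> a b \<eta> r \<beta>bar \<beta> \<kappa> h f \<epsilon> m x y"
proof -
  define next_x where "next_x p = fst p + min ((\<epsilon> / G (fst p) (snd p)) powr (1 / real (r + 1))) (b - fst p)"
    for p :: "real \<times> (real^'d)"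
  define st where "st = rec_nat (a, \<eta>) (\<lambda>i p. (next_x p, \<phi> f (fst p) (next_x p) (snd p) (next_x p)))"
  define x where "x i = fst (st i)" for i
  define y where "y i = snd (st i)" for i
  have x0: "x 0 = a" and y0: "y 0 = \<eta>" by (simp_all add: x_def y_def st_def)
  have x_Suc: "x (Suc i) = x i + min ((\<epsilon> / G (x i) (y i)) powr (1 / real (r + 1))) (b - x i)"
    and y_Suc: "y (Suc i) = \<phi> f (x i) (x (Suc i)) (y i) (x (Suc i))" for i
    by (simp_all add: x_def y_def st_def next_x_def)
  have x_le: "x i \<le> b" for i
    using ab x_Suc by (cases i) (auto simp: x0 min_def)
  have prefix: "run_prefix n x y" if "\<And>i. i < n \<Longrightarrow> x i \<noteq> b" for n
    using that x_le x0 y0 x_Suc y_Suc unfolding run_prefix_def by (metis order_le_less)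
  have "\<exists>m. x m = b"
  proof (rule ccontr)
    assume "\<nexists>m. x m = b"
    then have ne: "x i \<noteq> b" and run: "run_prefix n x y" for i n using prefix by blast+
    define \<sigma> where "\<sigma> = (\<epsilon> / (4 / 3 * \<beta>bar * (M + 2 * \<beta>) * (1 + \<kappa>))) powr (1 / real (r + 1))"
    have \<sigma>: "\<sigma> > 0" unfolding \<sigma>_def using \<epsilon>(1) bb \<beta> \<kappa> M_nonneg by (simp add: add_nonneg_eq_0_iff)
    have step: "x i + \<sigma> \<le> x (Suc i)" for i
    proof -
      have "x i < b" using ne x_le by (metis order_le_less)
      then have "G (x i) (y i) \<le> 4 / 3 * \<beta>bar * (M + 2 * \<beta>) * (1 + \<kappa>)"
        using run_near[OF run[of i]] run_local_error_bound[OF run[of i]] by (intro G_upper) auto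
      then have "\<epsilon> / (4 / 3 * \<beta>bar * (M + 2 * \<beta>) * (1 + \<kappa>)) \<le> \<epsilon> / G (x i) (y i)"
        using \<epsilon>(1) G_pos[of "x i" "y i"] by (intro frac_le) auto
      then have "\<sigma> \<le> (\<epsilon> / G (x i) (y i)) powr (1 / real (r + 1))"
        unfolding \<sigma>_def using \<epsilon>(1) bb \<beta> \<kappa> M_nonneg by (intro powr_mono2) auto
      then show ?thesis using x_Suc[of i] ne[of "Suc i"] by (auto simp: min_def split: if_splits)
    qed
    have "a + real n * \<sigma> \<le> x n" for n
    proof (induction n)
      case (Suc n)
      then show ?case using step[of n] by (simp add: algebra_simps)
    qed (simp add: x0)
    moreover obtain n where "(b - a) / \<sigma> < real n" using reals_Archimedean2 by blast
    ultimately show False using x_le[of n] \<sigma> by (smt (verit) pos_divide_less_eq)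
  qed
  then have "x (LEAST m. x m = b) = b" by (rule LeastI_ex)
  moreover have "run_prefix (LEAST m. x m = b) x y" by (rule prefix) (rule not_less_Least)
  ultimately show ?thesis unfolding adapt_mesh_gen_iff_run_prefix by blast
qed

end

section \<open>The error of the adaptive algorithm\<close>

lemma F_class_solution_tube:
  fixes f :: "'d::finite rhs"
  assumes ab: "a < b" and f: "f \<in> F_class a b \<eta> r"
  obtains L M z S F where "solution_tube a b L M \<eta> r f z S F"
    and "compact S" and "continuous_on S (F r)"
proof -
  obtain L0 z where cont: "continuous_on ({a..b} \<times> UNIV) (\<lambda>(t, y). f t y)"
    and L0: "L0 \<ge> 0" "\<And>t y y'. t \<in> {a..b} \<Longrightarrow> infnorm (f t y - f t y') \<le> L0 * infnorm (y - y')"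
    and sol: "solves_ivp f a b \<eta> z"
    and Ck: "Ck_on r (\<lambda>(t, y). f t y) ({a..b} \<times> {y. infnorm y \<le> (SUP t\<in>{a..b}. infnorm (z t)) + 1})"
    using f unfolding F_class_def by blast
  define K where "K = (SUP t\<in>{a..b}. infnorm (z t)) + 1"
  define S where "S = {a..b} \<times> {y :: real^'d. infnorm y \<le> K}"
  define L where "L = sqrt DIM(real^'d) * L0"
  have "bounded {y :: real^'d. infnorm y \<le> K}"
    unfolding bounded_iff
    by (rule exI[of _ "sqrt DIM(real^'d) * K"])
      (auto intro: order_trans[OF norm_le_infnorm] mult_left_mono)
  moreover have "closed {y :: real^'d. infnorm y \<le> K}"
    by (intro closed_Collect_le continuous_intros)
  ultimately have S: "compact S"
    unfolding S_def by (intro compact_Times) (auto simp: compact_eq_bounded_closed)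
  have lip: "norm (f t y - f t y') \<le> L * norm (y - y')" if t: "t \<in> {a..b}" for t y y'
  proof -
    have "norm (f t y - f t y') \<le> sqrt DIM(real^'d) * infnorm (f t y - f t y')"
      by (rule norm_le_infnorm)
    also have "\<dots> \<le> sqrt DIM(real^'d) * (L0 * norm (y - y'))"
      by (intro mult_left_mono order_trans[OF L0(2)[OF t]] infnorm_le_norm L0) auto
    finally show ?thesis by (simp add: L_def)
  qed
  have tube: "(t, y) \<in> S" if t: "t \<in> {a..b}" and y: "norm (y - z t) \<le> 1" for t y
  proof -
    have "continuous_on {a..b} z"
      using sol unfolding solves_ivp_def by (intro continuous_on_vector_derivative) auto
    then have "continuous_on {a..b} (\<lambda>t. infnorm (z t))" by (intro continuous_intros)
    then have "bdd_above ((\<lambda>t. infnorm (z t)) ` {a..b})"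
      by (intro bounded_imp_bdd_above compact_imp_bounded compact_continuous_image) auto
    then have "infnorm (z t) \<le> (SUP t\<in>{a..b}. infnorm (z t))" using t by (rule cSUP_upper2) auto
    moreover have "infnorm y \<le> infnorm (z t) + infnorm (y - z t)"
      using infnorm_triangle[of "z t" "y - z t"] by simp
    ultimately show ?thesis using infnorm_le_norm[of "y - z t"] y t by (simp add: S_def K_def)
  qed
  obtain F where F0: "F 0 = (\<lambda>(t, y). f t y)" and Fc: "\<And>j. j \<le> r \<Longrightarrow> continuous_on S (F j)"
    and F_Suc: "\<And>j. j < r \<Longrightarrow>
      \<exists>D. \<forall>p\<in>S. (F j has_derivative D p) (at p within S) \<and> F (Suc j) p = D p (1, F 0 p)"
  proof -
    from Ck_on_flow_chain[OF Ck Ck] obtain F where F: "F 0 = (\<lambda>(t, y). f t y)"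
      "\<forall>j\<le>r. continuous_on S (F j)"
      "\<forall>j<r. \<exists>D. \<forall>p\<in>S. (F j has_derivative D p) (at p within S) \<and>
        F (Suc j) p = D p (1, (\<lambda>(t, y). f t y) p)"
      unfolding S_def K_def by blast
    show thesis using that[of F] F(2,3) unfolding F(1)[symmetric] by blast
  qed
  have "\<exists>M. \<forall>p\<in>S. norm (F j p) \<le> M" if "j \<le> r" for j
    using compact_imp_bounded[OF compact_continuous_image[OF Fc[OF that] S]] by (auto simp: bounded_iff)
  from this[of 0] this[of r] obtain M0 M1
    where "\<forall>p\<in>S. norm (F 0 p) \<le> M0" "\<forall>p\<in>S. norm (F r p) \<le> M1" by auto
  then have M: "norm (F 0 p) \<le> max M0 M1" "norm (F r p) \<le> max M0 M1" if "p \<in> S" for p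
    using that by force+
  have "solution_tube a b L (max M0 M1) \<eta> r f z S F"
  proof (rule solution_tube.intro)
    show "0 \<le> L" using L0 by (simp add: L_def)
    show "F 0 (t, y) = f t y" for t y by (simp add: F0)
  qed (fact ab cont lip sol F_Suc tube M)+
  then show thesis using that S Fc by blast
qed

lemma eventually_mult_le_at_right_0:
  fixes A B :: real
  assumes "B > 0"
  shows "\<forall>\<^sub>F x in at_right 0. A * x \<le> B"
proof -
  have "((\<lambda>x. A * x) \<longlongrightarrow> A * 0) (at_right 0)" by (intro tendsto_intros)
  then have "\<forall>\<^sub>F x in at_right 0. A * x < B" by (rule order_tendstoD) (use assms in simp)
  then show ?thesis by eventually_elim simp
qed

theorem mainTheorem4:
  fixes a b \<beta>bar \<beta> \<kappa> :: real and r :: nat and \<eta> :: "real^'d::finite"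
    and \<phi> :: "'d ode_method" and f :: "'d rhs" and h :: "real \<Rightarrow> real"
  assumes "a < b" and "r \<ge> 1"
    and "\<beta>bar > 0" and "\<beta> > 0"
    and "is_method a b \<eta> r \<phi>"
    and "assumption_A a b \<eta> r \<beta>bar \<beta> \<phi>"
    and "f \<in> F_class a b \<eta> r"
    and "0 < \<kappa>" and "\<kappa> < 1"
    and "\<And>\<epsilon>. 0 < \<epsilon> \<Longrightarrow> \<epsilon> < 1 \<Longrightarrow> h \<epsilon> > 0"
    and "h \<in> O[at_right 0](\<lambda>\<epsilon>. \<epsilon> powr (1 / real (r + 1)))"
  shows "\<forall>\<^sub>F \<epsilon> in at_right 0.
           (\<exists>m x y. adapt_mesh_gen \<phi> a b \<eta> r \<beta>bar \<beta> \<kappa> h f \<epsilon> m x y) \<and>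
           (\<forall>m x y. adapt_mesh_gen \<phi> a b \<eta> r \<beta>bar \<beta> \<kappa> h f \<epsilon> m x y \<longrightarrow>
              mesh a b m x \<and>
              (\<forall>i<m. \<forall>z. solves_ivp f (x i) (x (Suc i)) (y i) z \<longrightarrow>
                 (SUP t\<in>{x i..x (Suc i)}.
                    ereal (infnorm (z t - \<phi> f (x i) (x (Suc i)) (y i) t))) \<le> ereal \<epsilon>))"
proof -
  let ?p = "1 / real (r + 1)"
  obtain L M z S F where tube: "solution_tube a b L M \<eta> r f z S F"
    and comp: "compact S" and Fr: "continuous_on S (F r)"
    using F_class_solution_tube[OF assms(1,7)] by blast
  interpret solution_tube a b L M \<eta> r f z S F by (rule tube)
  obtain \<delta>\<^sub>0 where \<delta>\<^sub>0: "\<delta>\<^sub>0 > 0"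
    "\<And>i x v. x 0 = a \<Longrightarrow> (\<And>j. j < i \<Longrightarrow> x j < x (Suc j) \<and> x (Suc j) - x j \<le> \<delta>\<^sub>0) \<Longrightarrow>
       x i < v \<Longrightarrow> v - x i \<le> \<delta>\<^sub>0 \<Longrightarrow> v \<le> b \<Longrightarrow>
       local_error_bound r \<beta>bar \<beta> \<phi> f (x i) v (method_value \<phi> f \<eta> x i)"
    using assumption_A_uniform[OF assms(1,6,7)] by blast
  have "uniformly_continuous_on S (F r)"
    using Fr comp by (rule compact_uniformly_continuous)
  then obtain \<rho> where \<rho>: "\<rho> > 0"
    "\<And>p q. p \<in> S \<Longrightarrow> q \<in> S \<Longrightarrow> dist p q < \<rho> \<Longrightarrow> dist (F r p) (F r q) < \<beta> / 9"
    using assms(4) unfolding uniformly_continuous_on_def by (metis zero_less_divide_iff zero_less_numeral)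
  define C where "C = sqrt DIM(real^'d) * (\<beta>bar * (M / fact r + \<beta>))"
  \<comment> \<open>The half of \<open>\<rho>\<close> turns the strict inequality in the uniform continuity into a weak one.\<close>
  have "\<forall>\<^sub>F \<delta> in at_right 0. \<delta> > 0 \<and> 1 * \<delta> \<le> \<delta>\<^sub>0 \<and> 1 * \<delta> \<le> 1 \<and> L * \<delta> \<le> 1/2 \<and>
      C * (b - a) * exp (2 * L * (b - a)) * \<delta> \<le> 1/2 \<and> (1 + M) * \<delta> \<le> \<rho> / 2 \<and>
      (2 * real r) ^ r * L * C * \<delta> \<le> \<beta> / 9"
    using \<delta>\<^sub>0(1) \<rho>(1) assms(4)
    by (intro eventually_conj eventually_mult_le_at_right_0 eventually_at_right_less) auto
  then obtain \<delta> where \<delta>: "\<delta> > 0" "\<delta> \<le> \<delta>\<^sub>0" "\<delta> \<le> 1" "L * \<delta> \<le> 1/2"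
      "C * (b - a) * exp (2 * L * (b - a)) * \<delta> \<le> 1/2" "(1 + M) * \<delta> \<le> \<rho> / 2"
      "(2 * real r) ^ r * L * C * \<delta> \<le> \<beta> / 9"
    by (auto dest: eventually_happens)
  have p0: "((\<lambda>\<epsilon>. (\<epsilon> / c) powr ?p) \<longlongrightarrow> 0) (at_right 0)" if "c > 0" for c :: real
  proof (rule tendsto_zero_powrI)
    show "((\<lambda>\<epsilon>. \<epsilon> / c) \<longlongrightarrow> 0) (at_right 0)"
      by (rule tendsto_divide_zero[OF tendsto_ident_at])
    show "\<forall>\<^sub>F \<epsilon> in at_right 0. 0 \<le> \<epsilon> / c"
      by (rule eventually_mono[OF eventually_at_right_less]) (use that in simp)
  qed auto
  obtain c where c: "\<forall>\<^sub>F \<epsilon> in at_right 0. norm (h \<epsilon>) \<le> c * norm (\<epsilon> powr ?p)"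
    using landau_o.bigE[OF assms(11)] by blast
  have "((\<lambda>\<epsilon>. c * norm ((\<epsilon> / 1) powr ?p)) \<longlongrightarrow> c * norm (0 :: real)) (at_right 0)"
    by (intro tendsto_intros p0) simp
  then have "\<forall>\<^sub>F \<epsilon> in at_right 0. c * norm ((\<epsilon> / 1) powr ?p) < \<delta>"
    by (rule order_tendstoD) (use \<delta> in simp)
  moreover have "\<forall>\<^sub>F \<epsilon> in at_right 0. (\<epsilon> / (4 / 3 * \<beta>bar * \<beta>)) powr ?p < \<delta>"
    by (rule order_tendstoD(2)[OF p0]) (use assms \<delta> in auto)
  \<comment> \<open>The bound on \<open>\<epsilon>\<close> keeps it inside \<open>(0, 1)\<close>, where \<open>h\<close> is positive.\<close>
  moreover have "\<forall>\<^sub>F \<epsilon> in at_right 0. 0 < \<epsilon> \<and> 1 * \<epsilon> \<le> (1/2 :: real)"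
    by (intro eventually_conj eventually_mult_le_at_right_0 eventually_at_right_less) simp
  ultimately show ?thesis
    using c
  proof eventually_elim
    fix \<epsilon> :: real
    assume \<epsilon>: "c * norm ((\<epsilon> / 1) powr ?p) < \<delta>" "(\<epsilon> / (4 / 3 * \<beta>bar * \<beta>)) powr ?p < \<delta>"
      "0 < \<epsilon> \<and> 1 * \<epsilon> \<le> 1/2" "norm (h \<epsilon>) \<le> c * norm (\<epsilon> powr ?p)"
    interpret adaptive_run a b L M \<eta> r f z S F \<phi> \<beta>bar \<beta> \<kappa> \<epsilon> \<delta> C h
    proof unfold_locales
      fix i x v
      assume x: "x 0 = a" "\<And>j. j < i \<Longrightarrow> x j < x (Suc j) \<and> x (Suc j) - x j \<le> \<delta>"
        "x i < v" "v - x i \<le> \<delta>" "v \<le> b"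
      show "local_error_bound r \<beta>bar \<beta> \<phi> f (x i) v (method_value \<phi> f \<eta> x i)"
        by (rule \<delta>\<^sub>0(2)) (use x \<delta>(2) order_trans in blast)+
    next
      fix p q assume "p \<in> S" "q \<in> S" "dist p q \<le> (1 + M) * \<delta>"
      then have "dist (F r p) (F r q) < \<beta> / 9" using \<delta>(6) \<rho> by (intro \<rho>(2)) auto
      then show "norm (F r p - F r q) \<le> \<beta> / 9" by (simp add: dist_norm)
    next
      show "C * \<delta> * (b - a) * exp (2 * L * (b - a)) \<le> 1/2" using \<delta>(5) by (simp only: mult_ac)
      show "0 < h \<epsilon>" using assms(10)[of \<epsilon>] \<epsilon>(3) by simp
      show "h \<epsilon> \<le> \<delta>" using \<epsilon>(1,4) by simp
      show "(\<epsilon> / (4 / 3 * \<beta>bar * \<beta>)) powr ?p \<le> \<delta>" using \<epsilon>(2) by linarith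
    qed (fact C_def assms \<delta> conjunct1[OF \<epsilon>(3)])+
    show "(\<exists>m x y. adapt_mesh_gen \<phi> a b \<eta> r \<beta>bar \<beta> \<kappa> h f \<epsilon> m x y) \<and>
           (\<forall>m x y. adapt_mesh_gen \<phi> a b \<eta> r \<beta>bar \<beta> \<kappa> h f \<epsilon> m x y \<longrightarrow>
              mesh a b m x \<and>
              (\<forall>i<m. \<forall>z. solves_ivp f (x i) (x (Suc i)) (y i) z \<longrightarrow>
                 (SUP t\<in>{x i..x (Suc i)}.
                    ereal (infnorm (z t - \<phi> f (x i) (x (Suc i)) (y i) t))) \<le> ereal \<epsilon>))"
      using run_exists run_correct by blast
  qed
qed

end
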